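(* Let $G$ be a group with a finite generating set $S$ and let $P$ be a pregroup with $G \simeq U(P)$, where $P$ is viewed as a subset of $G$. Suppose that $P$ satisfies all of the following axioms. (P6) For any $x,y \in P$, if $xy$ is not defined in $P$, but $xa$ and $a^{-1}y$ are both defined in $P$ for some $a \in P$, then $a \in B_P$. (H0) $B_P$ is finite. (H1) There exists a constant $C_1 > 0$ such that for every $p, q \in P$, any geodesic triangle on the vertices $\{1, p, pq\}$ in $\Gamma(G,S)$ is $C_1$-thin. (H2) There exists $C_2 > 0$ such that for any $p, q \in P$, if $(p^{-1} \cdot q)_1 > C_2$, then $pq \in P$. (H3) There exists a constant $C_3$ such that for every $p \in P$, every geodesic path $\gamma$ connecting $1$ and $p$ in $\Gamma(G,S)$ and every vertex $x \in G$ lying on $\gamma$, either $x \in P$, or $x$ can be represented as a reduced $P$-product $x = p_1 p_2$ (with $p_1,p_2 \in P$) where $|p_2| \leqslant C_3$. Then there exists $\delta > 0$ such that every geodesic triangle in $\Gamma(G,S)$ is $\delta$-thin. In particular, $G \simeq U(P)$ is word-hyperbolic.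
   Context: A pregroup is a set $P$ with a distinguished element $1$, a partial multiplication $D \to P$, $(x,y) \mapsto xy$, where $D \subset P \times P$ (one says $xy$ is defined if $(x,y) \in D$), and an inversion $P \to P$, $x \mapsto x^{-1}$, such that: (P1) for all $u \in P$, $u1$ and $1u$ are defined and $u1 = 1u = u$; (P2) for all $u \in P$, $u^{-1}u$ and $uu^{-1}$ are defined and equal $1$; (P3) for all $u,v \in P$, if $uv$ is defined then so is $v^{-1}u^{-1}$, and $(uv)^{-1} = v^{-1}u^{-1}$; (P4) for all $u,v,w \in P$, if $uv$ and $vw$ are defined, then $(uv)w$ is defined if and only if $u(vw)$ is defined, in which case $(uv)w = u(vw)$; (P5) for all $u,v,w,z \in P$, if $uv$, $vw$ and $wz$ are all defined then either $uvw$ or $vwz$ is defined. The universal group $U(P)$ is the group generated by $P$ subject to the relations $xy = z$ for all $x,y \in P$ such that $xy$ is defined in $P$ and equals $z$. The canonical map $P \to U(P)$ is injective, so when $G \simeq U(P)$ we view $P$ as a subset of $G$; then $(x,y) \in D$ if and only if $xy \in P$. A $P$-product is a finite sequence $u_1 \cdots u_n$ of elements of $P$; it represents the product of its terms in $G$. It is reduced if $u_i u_{i+1}$ is not defined in $P$ for every $i \in [1,n-1]$ (so a single element of $P$ is a reduced $P$-product with $n=1$). Set $B_P = \{b \in P \mid zb \text{ and } bz \text{ are defined for all } z \in P\}$. $\Gamma(G,S)$ is the Cayley graph of $G$ with respect to $S$, with the word metric $d$ (edges of length $1$), and $|g| = d(1,g)$ for $g \in G$. The Gromov product is $(x \cdot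 y)_v = \frac{1}{2}(d(x,v) + d(y,v) - d(x,y))$. A geodesic triangle is $\delta$-thin if each of its sides lies in the union of the $\delta$-neighborhoods of the other two sides. A finitely generated group is (word-)hyperbolic if for some finite generating set $S$ there is $\delta>0$ such that all geodesic triangles in its Cayley graph with respect to $S$ are $\delta$-thin. *)

theory Defs
  imports Complex_Main "HOL-Library.Indicator_Function" "HOL-Algebra.Generated_Groups"
begin

section \<open>Pregroups\<close>

text \<open>The partial multiplication is a total function \<open>mult\<close> of which only the values on the
  domain \<open>defd\<close> are relevant.\<close>

record 'p pregroup = "'p monoid" +
  defd :: "('p \<times> 'p) set"
  pinv :: "'p \<Rightarrow> 'p"

locale pregroup =
  fixes P :: "'p pregroup" (structure)
  assumes defd_subset: "defd P \<subseteq> carrier P \<times> carrier P"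
    and mult_closed: "\<And>u v. (u, v) \<in> defd P \<Longrightarrow> u \<otimes> v \<in> carrier P"
    and one_closed: "\<one> \<in> carrier P"
    and pinv_closed: "\<And>u. u \<in> carrier P \<Longrightarrow> pinv P u \<in> carrier P"
    and P1: "\<And>u. u \<in> carrier P \<Longrightarrow>
      (u, \<one>) \<in> defd P \<and> (\<one>, u) \<in> defd P \<and> u \<otimes> \<one> = u \<and> \<one> \<otimes> u = u"
    and P2: "\<And>u. u \<in> carrier P \<Longrightarrow>
      (pinv P u, u) \<in> defd P \<and> (u, pinv P u) \<in> defd P \<and> pinv P u \<otimes> u = \<one> \<and> u \<otimes> pinv P u = \<one>"
    and P3: "\<And>u v. (u, v) \<in> defd P \<Longrightarrow>
      (pinv P v, pinv P u) \<in> defd P \<and> pinv P (u \<otimes> v) = pinv P v \<otimes> pinv P u"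
    and P4: "\<And>u v w. (u, v) \<in> defd P \<Longrightarrow> (v, w) \<in> defd P \<Longrightarrow>
      ((u \<otimes> v, w) \<in> defd P \<longleftrightarrow> (u, v \<otimes> w) \<in> defd P) \<and>
      ((u \<otimes> v, w) \<in> defd P \<longrightarrow> (u \<otimes> v) \<otimes> w = u \<otimes> (v \<otimes> w))"
    \<comment> \<open>By (P4), the triple product \<open>uvw\<close> is defined iff \<open>(uv)w\<close> is.\<close>
    and P5: "\<And>u v w z. (u, v) \<in> defd P \<Longrightarrow> (v, w) \<in> defd P \<Longrightarrow> (w, z) \<in> defd P \<Longrightarrow>
      (u \<otimes> v, w) \<in> defd P \<or> (v \<otimes> w, z) \<in> defd P"

definition pregroup_base :: "'p pregroup \<Rightarrow> 'p set" where
  "pregroup_base P =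
    {b \<in> carrier P. \<forall>z \<in> carrier P. (z, b) \<in> defd P \<and> (b, z) \<in> defd P}"

definition reduced_product :: "'p pregroup \<Rightarrow> 'p list \<Rightarrow> bool" where
  "reduced_product P us \<longleftrightarrow> set us \<subseteq> carrier P \<and>
    (\<forall>i. Suc i < length us \<longrightarrow> (us ! i, us ! Suc i) \<notin> defd P)"


section \<open>Groups given by generators and relations\<close>

text \<open>A letter \<open>(True, x)\<close> stands for the generator \<open>x\<close> and \<open>(False, x)\<close> for its formal inverse.
  A pair \<open>(r, s)\<close> of words in \<open>R\<close> is the relation \<open>r = s\<close>.\<close>

definition words :: "'x set \<Rightarrow> (bool \<times> 'x) list set" where
  "words X = lists (UNIV \<times> X)"

inductive_set word_cong ::
  "'x set \<Rightarrow> ((bool \<times> 'x) list \<times> (bool \<times> 'x) list) set \<Rightarrow>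
    ((bool \<times> 'x) list \<times> (bool \<times> 'x) list) set"
  for X R where
  refl: "u \<in> words X \<Longrightarrow> (u, u) \<in> word_cong X R"
| sym: "(u, v) \<in> word_cong X R \<Longrightarrow> (v, u) \<in> word_cong X R"
| trans: "(u, v) \<in> word_cong X R \<Longrightarrow> (v, w) \<in> word_cong X R \<Longrightarrow> (u, w) \<in> word_cong X R"
| cong: "(u, v) \<in> word_cong X R \<Longrightarrow> a \<in> words X \<Longrightarrow> b \<in> words X \<Longrightarrow>
    (a @ u @ b, a @ v @ b) \<in> word_cong X R"
| cancel: "x \<in> X \<Longrightarrow> ([(e, x), (\<not> e, x)], []) \<in> word_cong X R"
| rel: "(r, s) \<in> R \<Longrightarrow> r \<in> words X \<Longrightarrow> s \<in> words X \<Longrightarrow> (r, s) \<in> word_cong X R"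

definition presented_group ::
  "'x set \<Rightarrow> ((bool \<times> 'x) list \<times> (bool \<times> 'x) list) set \<Rightarrow> (bool \<times> 'x) list set monoid" where
  "presented_group X R =
    \<lparr>carrier = words X // word_cong X R,
     mult = (\<lambda>A B. word_cong X R `` {u @ v | u v. u \<in> A \<and> v \<in> B}),
     one = word_cong X R `` {[]}\<rparr>"

definition pregroup_relations ::
  "'p pregroup \<Rightarrow> ((bool \<times> 'p) list \<times> (bool \<times> 'p) list) set" where
  "pregroup_relations P =
    {([(True, x), (True, y)], [(True, x \<otimes>\<^bsub>P\<^esub> y)]) | x y. (x, y) \<in> defd P}"

definition universal_group :: "'p pregroup \<Rightarrow> (bool \<times> 'p) list set monoid" where
  "universal_group P = presented_group (carrier P) (pregroup_relations P)"

definition canonical_map :: "'p pregroup \<Rightarrow> 'p \<Rightarrow> (bool \<times> 'p) list set" where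
  "canonical_map P p = word_cong (carrier P) (pregroup_relations P) `` {[(True, p)]}"

lemma word_cong_words:
  "(u, v) \<in> word_cong X R \<Longrightarrow> u \<in> words X \<and> v \<in> words X"
  by (induction rule: word_cong.induct) (auto simp: words_def)

lemma equiv_word_cong: "equiv (words X) (word_cong X R)"
proof (rule equivI)
  show "word_cong X R \<subseteq> words X \<times> words X"
    using word_cong_words by fastforce
  show "refl_on (words X) (word_cong X R)"
    by (auto simp: refl_on_def intro: word_cong.refl)
  show "Relation.sym (word_cong X R)" "Relation.trans (word_cong X R)"
    by (auto intro: symI transI word_cong.sym word_cong.trans)
qed

lemma words_append [simp]: "u @ v \<in> words X \<longleftrightarrow> u \<in> words X \<and> v \<in> words X"
  by (auto simp: words_def)

lemma word_cong_append:
  assumes "(u, u') \<in> word_cong X R" "(v, v') \<in> word_cong X R"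
  shows "(u @ v, u' @ v') \<in> word_cong X R"
proof -
  have w: "[] \<in> words X" "u' \<in> words X" "v \<in> words X"
    using word_cong_words[OF assms(1)] word_cong_words[OF assms(2)] by (auto simp: words_def)
  show ?thesis
    using word_cong.cong[OF assms(1) w(1) w(3)] word_cong.cong[OF assms(2) w(2) w(1)]
    by (auto intro: word_cong.trans)
qed

lemma presented_group_mult_class:
  assumes "u \<in> words X" "v \<in> words X"
  shows "word_cong X R `` {u} \<otimes>\<^bsub>presented_group X R\<^esub> word_cong X R `` {v} =
    word_cong X R `` {u @ v}"
proof -
  let ?r = "word_cong X R"
  have "?r `` {u' @ v' | u' v'. u' \<in> ?r `` {u} \<and> v' \<in> ?r `` {v}} = ?r `` {u @ v}" (is "?L = _")
  proof
    show "?L \<subseteq> ?r `` {u @ v}"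
      by (auto intro: word_cong.trans word_cong_append)
    show "?r `` {u @ v} \<subseteq> ?L"
      using assms by (auto intro: word_cong.refl)
  qed
  then show ?thesis by (simp add: presented_group_def)
qed

definition formal_inverse :: "(bool \<times> 'x) list \<Rightarrow> (bool \<times> 'x) list" where
  "formal_inverse u = rev (map (\<lambda>(e, x). (\<not> e, x)) u)"

lemma formal_inverse_words: "u \<in> words X \<Longrightarrow> formal_inverse u \<in> words X"
  by (auto simp: words_def formal_inverse_def)

lemma formal_inverse_cong:
  "u \<in> words X \<Longrightarrow> (formal_inverse u @ u, []) \<in> word_cong X R"
proof (induction u)
  case Nil
  then show ?case by (auto simp: formal_inverse_def intro: word_cong.refl)
next
  case (Cons a u)
  obtain e x where a: "a = (e, x)" by (cases a)
  have u: "u \<in> words X" and x: "x \<in> X" using Cons.prems a by (auto simp: words_def)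
  have "([(\<not> e, x), (\<not> \<not> e, x)], []) \<in> word_cong X R" by (rule word_cong.cancel[OF x])
  from word_cong.cong[OF this formal_inverse_words[OF u] u]
  have "(formal_inverse (a # u) @ (a # u), formal_inverse u @ u) \<in> word_cong X R"
    by (simp add: a formal_inverse_def)
  then show ?case using Cons.IH[OF u] word_cong.trans by blast
qed

lemma group_presented_group: "group (presented_group X R)"
proof (rule groupI)
  let ?G = "presented_group X R" and ?r = "word_cong X R"
  have carr: "carrier ?G = words X // ?r" and one: "\<one>\<^bsub>?G\<^esub> = ?r `` {[]}"
    by (simp_all add: presented_group_def)
  have nil: "[] \<in> words X" by (simp add: words_def)
  show "\<one>\<^bsub>?G\<^esub> \<in> carrier ?G" using nil by (simp add: carr one quotientI)
  show "A \<otimes>\<^bsub>?G\<^esub> B \<in> carrier ?G" if "A \<in> carrier ?G" "B \<in> carrier ?G" for A B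
    using that unfolding carr
    by (elim quotientE) (simp add: presented_group_mult_class quotientI)
  show "A \<otimes>\<^bsub>?G\<^esub> B \<otimes>\<^bsub>?G\<^esub> C = A \<otimes>\<^bsub>?G\<^esub> (B \<otimes>\<^bsub>?G\<^esub> C)"
    if "A \<in> carrier ?G" "B \<in> carrier ?G" "C \<in> carrier ?G" for A B C
    using that unfolding carr
    by (elim quotientE) (simp add: presented_group_mult_class)
  show "\<one>\<^bsub>?G\<^esub> \<otimes>\<^bsub>?G\<^esub> A = A" if "A \<in> carrier ?G" for A
    using that nil unfolding carr one
    by (elim quotientE) (simp add: presented_group_mult_class)
  show "\<exists>B \<in> carrier ?G. B \<otimes>\<^bsub>?G\<^esub> A = \<one>\<^bsub>?G\<^esub>" if "A \<in> carrier ?G" for A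
  proof -
    from that obtain u where u: "u \<in> words X" "A = ?r `` {u}"
      unfolding carr by (elim quotientE)
    have "?r `` {formal_inverse u @ u} = ?r `` {[]}"
      using equiv_class_eq[OF equiv_word_cong] formal_inverse_cong[OF u(1)] by fast
    then show ?thesis
      using u formal_inverse_words[OF u(1)] unfolding carr one
      by (intro bexI[of _ "?r `` {formal_inverse u}"])
        (simp_all add: presented_group_mult_class quotientI)
  qed
qed


section \<open>Geodesics and thin triangles\<close>

text \<open>Metric spaces are given by an underlying set \<open>M\<close> and a distance function \<open>d\<close>. Geodesics are
  parametrised by arc length.\<close>

definition gromov_product :: "('x \<Rightarrow> 'x \<Rightarrow> real) \<Rightarrow> 'x \<Rightarrow> 'x \<Rightarrow> 'x \<Rightarrow> real" where
  "gromov_product d x y v = (d x v + d y v - d x y) / 2"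

definition geodesic_path ::
  "'x set \<Rightarrow> ('x \<Rightarrow> 'x \<Rightarrow> real) \<Rightarrow> (real \<Rightarrow> 'x) \<Rightarrow> 'x \<Rightarrow> 'x \<Rightarrow> bool" where
  "geodesic_path M d \<gamma> x y \<longleftrightarrow>
    x \<in> M \<and> y \<in> M \<and> \<gamma> ` {0..d x y} \<subseteq> M \<and> \<gamma> 0 = x \<and> \<gamma> (d x y) = y \<and>
    (\<forall>s \<in> {0..d x y}. \<forall>t \<in> {0..d x y}. d (\<gamma> s) (\<gamma> t) = \<bar>s - t\<bar>)"

definition geodesic_segment ::
  "'x set \<Rightarrow> ('x \<Rightarrow> 'x \<Rightarrow> real) \<Rightarrow> 'x set \<Rightarrow> 'x \<Rightarrow> 'x \<Rightarrow> bool" where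
  "geodesic_segment M d A x y \<longleftrightarrow> (\<exists>\<gamma>. geodesic_path M d \<gamma> x y \<and> A = \<gamma> ` {0..d x y})"

definition geodesic_triangle ::
  "'x set \<Rightarrow> ('x \<Rightarrow> 'x \<Rightarrow> real) \<Rightarrow> 'x \<Rightarrow> 'x \<Rightarrow> 'x \<Rightarrow> 'x set \<Rightarrow> 'x set \<Rightarrow> 'x set \<Rightarrow> bool" where
  "geodesic_triangle M d x y z A B C \<longleftrightarrow>
    geodesic_segment M d A x y \<and> geodesic_segment M d B y z \<and> geodesic_segment M d C x z"

definition thin_triangle ::
  "('x \<Rightarrow> 'x \<Rightarrow> real) \<Rightarrow> real \<Rightarrow> 'x set \<Rightarrow> 'x set \<Rightarrow> 'x set \<Rightarrow> bool" where
  "thin_triangle d \<delta> A B C \<longleftrightarrow>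
    (\<forall>a \<in> A. \<exists>b \<in> B \<union> C. d a b \<le> \<delta>) \<and>
    (\<forall>b \<in> B. \<exists>c \<in> A \<union> C. d b c \<le> \<delta>) \<and>
    (\<forall>c \<in> C. \<exists>a \<in> A \<union> B. d c a \<le> \<delta>)"


section \<open>Word metric and Cayley graph\<close>

definition word_length :: "('a, 'b) monoid_scheme \<Rightarrow> 'a set \<Rightarrow> 'a \<Rightarrow> nat" where
  "word_length G S g = (LEAST n. \<exists>ws. set ws \<subseteq> S \<union> m_inv G ` S \<and> length ws = n \<and>
    foldr (mult G) ws \<one>\<^bsub>G\<^esub> = g)"

definition word_dist :: "('a, 'b) monoid_scheme \<Rightarrow> 'a set \<Rightarrow> 'a \<Rightarrow> 'a \<Rightarrow> real" where
  "word_dist G S g h = real (word_length G S (inv\<^bsub>G\<^esub> g \<otimes>\<^bsub>G\<^esub> h))"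

definition cayley_adj :: "('a, 'b) monoid_scheme \<Rightarrow> 'a set \<Rightarrow> 'a \<Rightarrow> 'a \<Rightarrow> bool" where
  "cayley_adj G S g h \<longleftrightarrow> g \<in> carrier G \<and> h \<in> carrier G \<and> g \<noteq> h \<and>
    inv\<^bsub>G\<^esub> g \<otimes>\<^bsub>G\<^esub> h \<in> S \<union> m_inv G ` S"

text \<open>The Cayley graph as a metric graph: its points are the vertices together with the points in
  the interior of the edges, given by their barycentric coordinates. So \<open>edge_point g h t\<close> is the
  point at distance \<open>t\<close> from \<open>g\<close> on the edge between \<open>g\<close> and \<open>h\<close>.\<close>

definition vertex :: "'a \<Rightarrow> 'a \<Rightarrow> real" where
  "vertex g = indicator {g}"

definition edge_point :: "'a \<Rightarrow> 'a \<Rightarrow> real \<Rightarrow> 'a \<Rightarrow> real" where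
  "edge_point g h t = (\<lambda>w. (1 - t) * vertex g w + t * vertex h w)"

definition cayley_graph :: "('a, 'b) monoid_scheme \<Rightarrow> 'a set \<Rightarrow> ('a \<Rightarrow> real) set" where
  "cayley_graph G S = vertex ` carrier G \<union>
    {edge_point g h t | g h t. cayley_adj G S g h \<and> 0 < t \<and> t < 1}"

definition supp :: "('a \<Rightarrow> real) \<Rightarrow> 'a set" where
  "supp x = {g. x g \<noteq> 0}"

text \<open>The path metric with edges of length \<open>1\<close>: two points with the same support lie in the
  interior of the same edge (or are the same vertex), and the segment of that edge between them
  is shortest; otherwise a shortest path leaves \<open>x\<close> through an endpoint \<open>g\<close> of its edge, which
  is at distance \<open>1 - x g\<close> from \<open>x\<close>, and reaches \<open>y\<close> through an endpoint \<open>h\<close> of its edge.\<close>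

definition cayley_dist ::
  "('a, 'b) monoid_scheme \<Rightarrow> 'a set \<Rightarrow> ('a \<Rightarrow> real) \<Rightarrow> ('a \<Rightarrow> real) \<Rightarrow> real" where
  "cayley_dist G S x y =
    (if supp x = supp y then (\<Sum>g \<in> supp x. \<bar>x g - y g\<bar>) / 2
     else Min ((\<lambda>(g, h). (1 - x g) + word_dist G S g h + (1 - y h)) ` (supp x \<times> supp y)))"

definition cayley_thin :: "('a, 'b) monoid_scheme \<Rightarrow> 'a set \<Rightarrow> real \<Rightarrow> bool" where
  "cayley_thin G S \<delta> \<longleftrightarrow>
    (\<forall>x y z A B C. geodesic_triangle (cayley_graph G S) (cayley_dist G S) x y z A B C \<longrightarrow>
      thin_triangle (cayley_dist G S) \<delta> A B C)"

definition word_hyperbolic :: "('a, 'b) monoid_scheme \<Rightarrow> bool" where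
  "word_hyperbolic G \<longleftrightarrow> group G \<and>
    (\<exists>S. finite S \<and> S \<subseteq> carrier G \<and> generate G S = carrier G \<and> (\<exists>\<delta>>0. cayley_thin G S \<delta>))"


section \<open>The distance on the Cayley graph\<close>

text \<open>If \<open>S\<close> generates \<open>G\<close>, then \<open>cayley_dist\<close> is a metric on the Cayley graph which extends the word
  metric and for which every edge is isometric to the unit interval.\<close>

locale generated_group = group G for G (structure) +
  fixes S :: "'a set"
  assumes S: "S \<subseteq> carrier G" and gen: "generate G S = carrier G"
begin

definition letters :: "'a set" where "letters = S \<union> m_inv G ` S"

definition spells :: "'a list \<Rightarrow> 'a \<Rightarrow> bool" where
  "spells ws g \<longleftrightarrow> set ws \<subseteq> letters \<and> foldr (mult G) ws \<one> = g"

lemma letters_closed: "letters \<subseteq> carrier G"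
  using S by (auto simp: letters_def)

lemma letters_inv: "a \<in> letters \<Longrightarrow> inv a \<in> letters"
  using S by (auto simp: letters_def)

lemma word_length_Least: "word_length G S g = (LEAST n. \<exists>ws. spells ws g \<and> length ws = n)"
  unfolding word_length_def spells_def letters_def by (rule arg_cong[where f = Least]) auto

lemma foldr_closed: "set ws \<subseteq> letters \<Longrightarrow> foldr (mult G) ws \<one> \<in> carrier G"
  using letters_closed by (induction ws) auto

lemma spells_append:
  assumes "spells u g" "spells v h" shows "spells (u @ v) (g \<otimes> h)"
proof -
  have h: "h \<in> carrier G" using assms foldr_closed by (auto simp: spells_def)
  have "foldr (mult G) u h = foldr (mult G) u \<one> \<otimes> h" if "set u \<subseteq> letters"
    using that
  proof (induction u)
    case (Cons a u)
    then have "a \<in> carrier G" "foldr (mult G) u \<one> \<in> carrier G"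
      using letters_closed foldr_closed[of u] by auto
    with Cons h show ?case by (simp add: m_assoc)
  qed (use h in simp)
  with assms show ?thesis by (auto simp: spells_def)
qed

lemma spells_inv: "spells u g \<Longrightarrow> spells (rev (map (m_inv G) u)) (inv g)"
proof (induction u arbitrary: g)
  case Nil
  then show ?case by (auto simp: spells_def)
next
  case (Cons a u)
  let ?h = "foldr (mult G) u \<one>"
  have a: "a \<in> letters" and u: "spells u ?h" and g: "g = a \<otimes> ?h" and h: "?h \<in> carrier G"
    using Cons.prems foldr_closed[of u] by (auto simp: spells_def)
  have ac: "a \<in> carrier G" using a letters_closed by auto
  have "spells [inv a] (inv a)" using letters_inv[OF a] ac by (simp add: spells_def)
  from spells_append[OF Cons.IH[OF u] this] show ?case
    using ac h by (simp add: g inv_mult_group)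
qed

lemma spells_exists: "g \<in> carrier G \<Longrightarrow> \<exists>ws. spells ws g"
proof -
  have "\<exists>ws. spells ws g" if "g \<in> generate G S" for g
    using that
  proof induction
    case one then show ?case by (auto simp: spells_def intro: exI[of _ "[]"])
  next
    case (incl h) then have "spells [h] h" using S by (auto simp: spells_def letters_def)
    then show ?case ..
  next
    case (inv h) then have "spells [inv h] (inv h)" using S by (auto simp: spells_def letters_def)
    then show ?case ..
  next
    case (eng h1 h2) then show ?case using spells_append by blast
  qed
  then show "g \<in> carrier G \<Longrightarrow> \<exists>ws. spells ws g" by (simp add: gen)
qed

lemma word_length_le: "spells ws g \<Longrightarrow> word_length G S g \<le> length ws"
  unfolding word_length_Least by (rule Least_le) auto

lemma word_length_attained:
  assumes "g \<in> carrier G" obtains ws where "spells ws g" "length ws = word_length G S g"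
proof -
  have "\<exists>n ws. spells ws g \<and> length ws = n" using spells_exists[OF assms] by blast
  from LeastI_ex[OF this] have "\<exists>ws. spells ws g \<and> length ws = word_length G S g"
    by (simp only: word_length_Least)
  then show ?thesis using that by blast
qed

lemma word_length_eq_0: "g \<in> carrier G \<Longrightarrow> word_length G S g = 0 \<longleftrightarrow> g = \<one>"
proof
  assume g: "g \<in> carrier G" "word_length G S g = 0"
  then show "g = \<one>" by (metis word_length_attained length_0_conv spells_def foldr_Nil id_apply)
next
  assume "g = \<one>" then have "spells [] g" by (simp add: spells_def)
  from word_length_le[OF this] show "word_length G S g = 0" by simp
qed

lemma word_length_inv_le: "g \<in> carrier G \<Longrightarrow> word_length G S (inv g) \<le> word_length G S g"
  by (metis word_length_attained word_length_le spells_inv length_rev length_map)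

lemma word_length_inv: "g \<in> carrier G \<Longrightarrow> word_length G S (inv g) = word_length G S g"
  using word_length_inv_le[of g] word_length_inv_le[of "inv g"] by simp

lemma word_length_mult:
  "g \<in> carrier G \<Longrightarrow> h \<in> carrier G \<Longrightarrow>
    word_length G S (g \<otimes> h) \<le> word_length G S g + word_length G S h"
  by (metis word_length_attained word_length_le spells_append length_append)

lemma word_dist_nonneg: "0 \<le> word_dist G S g h"
  by (simp add: word_dist_def)

lemma word_dist_commute:
  assumes "g \<in> carrier G" "h \<in> carrier G" shows "word_dist G S g h = word_dist G S h g"
  using word_length_inv[of "inv g \<otimes> h"] assms by (simp add: word_dist_def inv_mult_group)

lemma word_dist_zero:
  assumes "g \<in> carrier G" "h \<in> carrier G" shows "word_dist G S g h = 0 \<longleftrightarrow> g = h"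
  using assms by (auto simp: word_dist_def word_length_eq_0 inv_solve_left')

lemma word_dist_triangle:
  assumes "g \<in> carrier G" "h \<in> carrier G" "k \<in> carrier G"
  shows "word_dist G S g k \<le> word_dist G S g h + word_dist G S h k"
proof -
  have "inv g \<otimes> k = (inv g \<otimes> h) \<otimes> (inv h \<otimes> k)"
    using assms inv_solve_left[of h "inv h \<otimes> k" k] by (simp add: m_assoc flip: m_assoc[of h "inv h" k])
  then show ?thesis
    using word_length_mult[of "inv g \<otimes> h" "inv h \<otimes> k"] assms
    by (simp add: word_dist_def flip: of_nat_add)
qed

lemma word_dist_ge_1:
  assumes "g \<in> carrier G" "h \<in> carrier G" "g \<noteq> h" shows "1 \<le> word_dist G S g h"
  using word_dist_zero[OF assms(1,2)] assms(3) by (simp add: word_dist_def)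

lemma word_dist_adj:
  assumes "cayley_adj G S g h" shows "word_dist G S g h = 1"
proof (rule antisym)
  have gh: "g \<in> carrier G" "h \<in> carrier G" "g \<noteq> h" "inv g \<otimes> h \<in> letters"
    using assms by (auto simp: cayley_adj_def letters_def)
  then have "spells [inv g \<otimes> h] (inv g \<otimes> h)" by (simp add: spells_def)
  from word_length_le[OF this] show "word_dist G S g h \<le> 1" by (simp add: word_dist_def)
  show "1 \<le> word_dist G S g h" using word_dist_ge_1 gh by blast
qed

lemma supp_vertex [simp]: "supp (vertex g) = {g}"
  by (auto simp: supp_def vertex_def indicator_def split: if_splits)

lemma supp_edge_point: "0 < t \<Longrightarrow> t < 1 \<Longrightarrow> supp (edge_point g h t) = {g, h}"
  by (auto simp: supp_def edge_point_def vertex_def indicator_def split: if_splits)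

lemma cayley_graph_cases:
  assumes "x \<in> cayley_graph G S"
  obtains (vert) g where "g \<in> carrier G" "x = vertex g" "supp x = {g}" "x g = 1"
  | (edge) g h where "cayley_adj G S g h" "supp x = {g, h}" "x g + x h = 1" "0 < x g" "0 < x h"
proof -
  consider g where "g \<in> carrier G" "x = vertex g"
    | g h t where "cayley_adj G S g h" "0 < t" "t < 1" "x = edge_point g h t"
    using assms unfolding cayley_graph_def by auto
  then show ?thesis
  proof cases
    case 1
    show ?thesis by (rule vert[OF 1]) (simp_all add: 1(2), simp add: vertex_def)
  next
    case 2
    then have "g \<noteq> h" by (simp add: cayley_adj_def)
    with 2 show ?thesis
      using edge[of g h] by (simp add: supp_edge_point) (simp add: edge_point_def vertex_def)
  qed
qed

lemma point_supp:
  assumes "x \<in> cayley_graph G S"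
  shows "finite (supp x)" "supp x \<noteq> {}" "supp x \<subseteq> carrier G"
  using assms by (cases rule: cayley_graph_cases; simp add: cayley_adj_def)+

lemma point_coord:
  assumes "x \<in> cayley_graph G S" "g \<in> supp x"
  shows "0 < x g \<and> x g \<le> 1"
  using assms(1)
proof (cases rule: cayley_graph_cases)
  case (edge k l)
  then have "g = k \<or> g = l" using assms(2) by blast
  with edge show ?thesis by (elim disjE) simp_all
qed (use assms(2) in simp)

lemma point_single:
  assumes "x \<in> cayley_graph G S" "supp x = {g}"
  shows "x g = 1"
  using assms(1)
proof (cases rule: cayley_graph_cases)
  case (edge k l)
  then have "k \<noteq> l" by (simp add: cayley_adj_def)
  with edge assms(2) show ?thesis by (simp add: doubleton_eq_iff)
qed (use assms(2) in simp)

lemma point_other: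
  assumes "x \<in> cayley_graph G S" "g \<in> supp x" "h \<in> supp x" "g \<noteq> h"
  shows "x g + x h = 1 \<and> supp x = {g, h} \<and> word_dist G S g h = 1"
  using assms(1)
proof (cases rule: cayley_graph_cases)
  case (edge k l)
  have kl: "word_dist G S k l = 1" "word_dist G S l k = 1"
    using edge(1) word_dist_adj[OF edge(1)] word_dist_commute[of k l] by (auto simp: cayley_adj_def)
  have "g = k \<and> h = l \<or> g = l \<and> h = k" using assms(2-4) unfolding edge(2) by auto
  with edge kl show ?thesis by (elim disjE) (simp_all add: insert_commute add.commute)
qed (use assms in simp)

lemma point_one:
  assumes "x \<in> cayley_graph G S" "g \<in> supp x" "x g = 1"
  shows "supp x = {g}"
  using assms(1)
proof (cases rule: cayley_graph_cases)
  case (edge k l)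
  then have "g = k \<or> g = l" using assms(2) by blast
  with edge assms(3) show ?thesis by (elim disjE) simp_all
qed (use assms in simp)

lemma same_supp_dist:
  assumes x: "x \<in> cayley_graph G S" and y: "y \<in> cayley_graph G S"
    and eq: "supp x = supp y" and g: "g \<in> supp x"
  shows "cayley_dist G S x y = \<bar>x g - y g\<bar>"
proof (cases "\<exists>h \<in> supp x. h \<noteq> g")
  case True
  then obtain h where h: "h \<in> supp x" "g \<noteq> h" by auto
  have s: "supp x = {g, h}" "x g + x h = 1" "y g + y h = 1"
    using point_other[OF x g h(1) h(2)] point_other[OF y, of g h] g h eq by auto
  have "\<bar>x g - y g\<bar> = \<bar>x h - y h\<bar>" using s by linarith
  moreover have "supp y = {g, h}" using eq s by simp
  ultimately show ?thesis using s(1) h by (simp add: cayley_dist_def)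
next
  case False
  with g have s: "supp x = {g}" by blast
  moreover have sy: "supp y = {g}" using eq s by simp
  moreover have "x g = 1" "y g = 1" using point_single[OF x s] point_single[OF y sy] .
  ultimately show ?thesis using s by (simp add: cayley_dist_def)
qed

lemma diff_supp_dist_le:
  assumes x: "x \<in> cayley_graph G S" and y: "y \<in> cayley_graph G S"
    and ne: "supp x \<noteq> supp y" and g: "g \<in> supp x" "h \<in> supp y"
  shows "cayley_dist G S x y \<le> (1 - x g) + word_dist G S g h + (1 - y h)"
proof -
  have "finite (supp x \<times> supp y)" using point_supp x y by blast
  then show ?thesis unfolding cayley_dist_def using ne g by (force intro!: Min_le)
qed

lemma diff_supp_dist_attained:
  assumes x: "x \<in> cayley_graph G S" and y: "y \<in> cayley_graph G S"
    and ne: "supp x \<noteq> supp y"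
  obtains g h where "g \<in> supp x" "h \<in> supp y"
    "cayley_dist G S x y = (1 - x g) + word_dist G S g h + (1 - y h)"
proof -
  let ?A = "(\<lambda>(g, h). (1 - x g) + word_dist G S g h + (1 - y h)) ` (supp x \<times> supp y)"
  have "finite ?A" "?A \<noteq> {}" using point_supp(1,2) x y by auto
  then have "Min ?A \<in> ?A" by (rule Min_in)
  moreover have "cayley_dist G S x y = Min ?A" using ne by (simp add: cayley_dist_def)
  ultimately show ?thesis using that by auto
qed

lemma dist_le:
  assumes x: "x \<in> cayley_graph G S" and y: "y \<in> cayley_graph G S"
    and g: "g \<in> supp x" "h \<in> supp y"
  shows "cayley_dist G S x y \<le> (1 - x g) + word_dist G S g h + (1 - y h)"
proof (cases "supp x = supp y")
  case True
  have c: "0 < x g" "x g \<le> 1" "0 < y g" "y g \<le> 1" "y h \<le> 1"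
    using point_coord[OF x] point_coord[OF y] g True by auto
  have "\<bar>x g - y g\<bar> \<le> (1 - x g) + word_dist G S g h + (1 - y h)"
  proof (cases "g = h")
    case True
    with c word_dist_nonneg[of g h] show ?thesis by simp
  next
    case False
    have "word_dist G S g h = 1" using point_other[OF x g(1) _ False] g(2) True by simp
    with c show ?thesis by simp
  qed
  with same_supp_dist[OF x y True g(1)] show ?thesis by simp
qed (rule diff_supp_dist_le[OF x y _ g])

lemma cayley_dist_nonneg:
  assumes x: "x \<in> cayley_graph G S" and y: "y \<in> cayley_graph G S"
  shows "0 \<le> cayley_dist G S x y"
proof (cases "supp x = supp y")
  case True then show ?thesis by (simp add: cayley_dist_def sum_nonneg)
next
  case False
  from diff_supp_dist_attained[OF x y False] obtain g h where g: "g \<in> supp x" "h \<in> supp y"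
    "cayley_dist G S x y = (1 - x g) + word_dist G S g h + (1 - y h)" .
  with point_coord[OF x g(1)] point_coord[OF y g(2)] word_dist_nonneg[of g h]
  show ?thesis by linarith
qed

lemma cayley_dist_commute:
  assumes x: "x \<in> cayley_graph G S" and y: "y \<in> cayley_graph G S"
  shows "cayley_dist G S x y = cayley_dist G S y x"
proof -
  have *: "cayley_dist G S x y \<le> cayley_dist G S y x"
    if x: "x \<in> cayley_graph G S" and y: "y \<in> cayley_graph G S" for x y
  proof (cases "supp x = supp y")
    case True then show ?thesis by (simp add: cayley_dist_def abs_minus_commute)
  next
    case False
    then have "supp y \<noteq> supp x" by simp
    from diff_supp_dist_attained[OF y x this] obtain g h where g: "g \<in> supp y" "h \<in> supp x"
      "cayley_dist G S y x = (1 - y g) + word_dist G S g h + (1 - x h)" .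
    moreover have "word_dist G S h g = word_dist G S g h"
      using word_dist_commute point_supp(3) x y g by blast
    ultimately show ?thesis using dist_le[OF x y g(2,1)] by simp
  qed
  show ?thesis using *[OF x y] *[OF y x] by simp
qed

lemma cayley_dist_zero:
  assumes x: "x \<in> cayley_graph G S" and y: "y \<in> cayley_graph G S"
  shows "cayley_dist G S x y = 0 \<longleftrightarrow> x = y"
proof
  assume 0: "cayley_dist G S x y = 0"
  show "x = y"
  proof (cases "supp x = supp y")
    case True
    then have "x g = y g" if "g \<in> supp x" for g
      using same_supp_dist[OF x y True that] 0 by simp
    moreover have "x g = y g" if "g \<notin> supp x" for g
      using that True by (auto simp: supp_def)
    ultimately show ?thesis by blast
  next
    case False
    from diff_supp_dist_attained[OF x y False] obtain g h where g: "g \<in> supp x" "h \<in> supp y"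
      "cayley_dist G S x y = (1 - x g) + word_dist G S g h + (1 - y h)" .
    then have "x g = 1" "y h = 1" "word_dist G S g h = 0"
      using 0 point_coord[OF x g(1)] point_coord[OF y g(2)] word_dist_nonneg[of g h] by auto
    moreover have "g \<in> carrier G" "h \<in> carrier G" using point_supp(3) x y g by blast+
    ultimately have "supp x = {g}" "supp y = {h}" "g = h"
      using point_one[OF x g(1)] point_one[OF y g(2)] word_dist_zero by auto
    with False show ?thesis by simp
  qed
next
  assume "x = y" then show "cayley_dist G S x y = 0" by (simp add: cayley_dist_def)
qed

lemma cayley_dist_triangle:
  assumes x: "x \<in> cayley_graph G S" and y: "y \<in> cayley_graph G S" and z: "z \<in> cayley_graph G S"
  shows "cayley_dist G S x z \<le> cayley_dist G S x y + cayley_dist G S y z"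
proof -
  consider "supp x = supp y" "supp y = supp z" | "supp x = supp y" "supp y \<noteq> supp z"
    | "supp x \<noteq> supp y" "supp y = supp z" | "supp x \<noteq> supp y" "supp y \<noteq> supp z" by blast
  then show ?thesis
  proof cases
    case 1
    obtain g where g: "g \<in> supp x" using point_supp(2)[OF x] by blast
    show ?thesis using same_supp_dist[OF x y _ g] same_supp_dist[OF y z _, of g]
        same_supp_dist[OF x z _ g] 1 g by auto
  next
    case 2
    from diff_supp_dist_attained[OF y z 2(2)] obtain g h where g: "g \<in> supp y" "h \<in> supp z"
      "cayley_dist G S y z = (1 - y g) + word_dist G S g h + (1 - z h)" .
    then show ?thesis
      using dist_le[OF x z _ g(2), of g] same_supp_dist[OF x y 2(1), of g] 2 by auto
  next
    case 3
    from diff_supp_dist_attained[OF x y 3(1)] obtain g h where g: "g \<in> supp x" "h \<in> supp y"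
      "cayley_dist G S x y = (1 - x g) + word_dist G S g h + (1 - y h)" .
    then show ?thesis
      using dist_le[OF x z g(1), of h] same_supp_dist[OF y z 3(2), of h] 3 by auto
  next
    case 4
    from diff_supp_dist_attained[OF x y 4(1)] obtain g h where g: "g \<in> supp x" "h \<in> supp y"
      "cayley_dist G S x y = (1 - x g) + word_dist G S g h + (1 - y h)" .
    from diff_supp_dist_attained[OF y z 4(2)] obtain h' k where h': "h' \<in> supp y" "k \<in> supp z"
      "cayley_dist G S y z = (1 - y h') + word_dist G S h' k + (1 - z k)" .
    have c: "g \<in> carrier G" "h \<in> carrier G" "h' \<in> carrier G" "k \<in> carrier G"
      using point_supp(3) x y z g h' by blast+
    have "word_dist G S h h' \<le> (1 - y h) + (1 - y h')"
    proof (cases "h = h'")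
      case True
      then show ?thesis using word_dist_zero[of h h'] c point_coord[OF y g(2)] by simp
    next
      case False
      then show ?thesis using point_other[OF y g(2) h'(1)] by simp
    qed
    then show ?thesis
      using dist_le[OF x z g(1) h'(2)] word_dist_triangle[of g h k] word_dist_triangle[of h h' k]
        c g(3) h'(3) by simp
  qed
qed

lemma cayley_dist_vertex:
  assumes "g \<in> carrier G" "h \<in> carrier G"
  shows "cayley_dist G S (vertex g) (vertex h) = word_dist G S g h"
  using assms word_dist_zero[of g h]
  by (cases "g = h") (auto simp: cayley_dist_def, auto simp: vertex_def)

lemma vertex_in_cayley_graph: "g \<in> carrier G \<Longrightarrow> vertex g \<in> cayley_graph G S"
  by (simp add: cayley_graph_def)

lemma edge_isometric:
  assumes "cayley_adj G S g h"
  shows "geodesic_path (cayley_graph G S) (cayley_dist G S) (edge_point g h) (vertex g) (vertex h)"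
proof -
  have gh: "g \<in> carrier G" "h \<in> carrier G" "g \<noteq> h" using assms by (auto simp: cayley_adj_def)
  have d: "cayley_dist G S (vertex g) (vertex h) = 1"
    using cayley_dist_vertex[OF gh(1,2)] word_dist_adj[OF assms] by simp
  have e: "edge_point g h 0 = vertex g" "edge_point g h 1 = vertex h"
    by (auto simp: edge_point_def)
  have m: "edge_point g h t \<in> cayley_graph G S" if "0 \<le> t" "t \<le> 1" for t
  proof (cases "t = 0 \<or> t = 1")
    case True then show ?thesis using e gh vertex_in_cayley_graph by auto
  next
    case False
    then have "0 < t" "t < 1" using that by auto
    then show ?thesis using assms unfolding cayley_graph_def by blast
  qed
  have w: "word_dist G S g h = 1" "word_dist G S h g = 1" "word_dist G S g g = 0"
      "word_dist G S h h = 0"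
    using word_dist_adj[OF assms] word_dist_commute[of g h] word_dist_zero gh by auto
  have val: "edge_point g h t g = 1 - t" "edge_point g h t h = t" for t
    using gh by (auto simp: edge_point_def vertex_def)
  have sp: "supp (edge_point g h t) = (if t = 0 then {g} else if t = 1 then {h} else {g, h})"
    if "0 \<le> t" "t \<le> 1" for t
    using that by (auto simp: e supp_edge_point)
  have dd: "cayley_dist G S (edge_point g h s) (edge_point g h t) = \<bar>s - t\<bar>"
    if "s \<in> {0..1}" "t \<in> {0..1}" for s t
    using that gh sp[of s] sp[of t] val[of s] val[of t] w
    by (cases "s = 0"; cases "s = 1"; cases "t = 0"; cases "t = 1")
      (auto simp: cayley_dist_def Min_insert2 min_def)
  show ?thesis
    unfolding geodesic_path_def d using e m dd gh vertex_in_cayley_graph by auto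
qed

end

end

theory Submission
  imports Defs
begin

text \<open>
  Reduced products of a pregroup play the role of geodesics. Under (P6) two reduced products of the
  same element have the same length and differ only by sliding elements of the finite group
  \<open>B = pregroup_base P\<close> between neighbouring factors (\<open>reduced_unique\<close>). To multiply two reduced
  products one cancels: while the last factor \<open>u\<close> of the first and the first factor \<open>v\<close> of the second
  have a product in \<open>B\<close>, drop both and carry that element of \<open>B\<close> along. When this stops, either \<open>uv\<close>
  is undefined and the products are concatenated, or \<open>uv\<close> lies in \<open>P\<close> outside \<open>B\<close>, and (P6) makes
  the product with \<open>u\<close>, \<open>v\<close> merged into one factor reduced. So three points of \<open>G\<close> span a tripod of
  reduced products, whose centre is either a point or a triangle with all three sides in \<open>P\<close>.

  Assign to points \<open>x\<close>, \<open>y\<close> of \<open>G\<close> the union \<open>tracks x y\<close> of all paths from \<open>x\<close> to \<open>y\<close> that are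
  spelled by a reduced product, each factor being traversed along geodesics. In the tripod above,
  two factors that cancel are inverse to each other up to elements of \<open>B\<close>, so that (H1), applied to the
  thin triangles that such factors span and to the central triangle, puts \<open>tracks x y\<close> into a bounded neighbourhood
  of \<open>tracks x z \<union> tracks y z\<close> (\<open>track_near_product\<close>, \<open>tracks_thin\<close>). Here the carried element of
  \<open>B\<close> is what keeps the error from adding up along the cancellation: each factor is compared just once.

  These are the hypotheses of the principle of guessing geodesics (locale \<open>guessed_geodesics\<close>): if a
  metric space has connected sets \<open>L x y\<close> that form uniformly thin triangles and are uniformly bounded
  when \<open>x\<close> and \<open>y\<close> are close, then every geodesic runs uniformly close to the set \<open>L x y\<close> of its
  endpoints, and conversely, so that geodesic triangles are thin. The boundedness comes from the
  uniqueness of reduced products: the finitely many elements of a ball of \<open>G\<close> have reduced products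
  of bounded total length.

  The whole argument uses (H1) only through a statement about distances in \<open>G\<close> (\<open>between\<close>), which
  any isomorphism of groups carries over. It therefore applies to \<open>universal_group P\<close> with the
  corresponding generating set as well as to \<open>G\<close>.
\<close>

section \<open>Guessing geodesics\<close>

text \<open>The sets \<open>L x y\<close> are guesses for geodesics. \<open>L_chain\<close> says that they connect their endpoints at scale
\<open>h\<close>. The third side of the triangle in \<open>L_thin\<close> runs from \<open>y\<close> to \<open>z\<close>, because this is how cancellation
of reduced products delivers it.\<close>

locale guessed_geodesics =
  fixes M :: "'x set" and d :: "'x \<Rightarrow> 'x \<Rightarrow> real" and L :: "'x \<Rightarrow> 'x \<Rightarrow> 'x set" and h :: real
  assumes commute: "\<And>x y. x \<in> M \<Longrightarrow> y \<in> M \<Longrightarrow> d x y = d y x"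
    and triangle: "\<And>x y z. x \<in> M \<Longrightarrow> y \<in> M \<Longrightarrow> z \<in> M \<Longrightarrow> d x z \<le> d x y + d y z"
    and zero: "\<And>x. x \<in> M \<Longrightarrow> d x x = 0"
    and h_pos: "0 < h"
    and L_closed: "\<And>x y. x \<in> M \<Longrightarrow> y \<in> M \<Longrightarrow> L x y \<subseteq> M"
    and L_thin: "\<And>x y z a. x \<in> M \<Longrightarrow> y \<in> M \<Longrightarrow> z \<in> M \<Longrightarrow> a \<in> L x y \<Longrightarrow>
      \<exists>b \<in> L x z \<union> L y z. d a b \<le> h"
    and L_short: "\<And>x y a. x \<in> M \<Longrightarrow> y \<in> M \<Longrightarrow> d x y \<le> 1 \<Longrightarrow> a \<in> L x y \<Longrightarrow> d x a \<le> h"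
    and L_chain: "\<And>x y. x \<in> M \<Longrightarrow> y \<in> M \<Longrightarrow> \<exists>a \<in> L x y. \<exists>b \<in> L x y. d x a \<le> h \<and> d y b \<le> h \<and>
      (a, b) \<in> {(u, v). u \<in> L x y \<and> v \<in> L x y \<and> d u v \<le> h}\<^sup>*"
begin

text \<open>Thinness of the degenerate triangle \<open>x, y, x\<close>, in which \<open>L x x\<close> stays close to \<open>x\<close>, makes the guesses
coarsely symmetric.\<close>

lemma L_swap:
  assumes x: "x \<in> M" and y: "y \<in> M" and a: "a \<in> L x y"
  shows "\<exists>b \<in> L y x. d a b \<le> 3 * h"
proof -
  obtain b where b: "b \<in> L x x \<union> L y x" "d a b \<le> h" using L_thin[OF x y x a] by blast
  show ?thesis
  proof (cases "b \<in> L y x")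
    case True
    then show ?thesis using b h_pos by (intro bexI[of _ b]) auto
  next
    case False
    then have bx: "b \<in> L x x" "d x b \<le> h" using b L_short[OF x x] zero[OF x] by auto
    obtain c where c: "c \<in> L y x" "d x c \<le> h" using L_chain[OF y x] by blast
    have m: "a \<in> M" "b \<in> M" "c \<in> M" using L_closed x y a bx c by blast+
    have "d a c \<le> d a b + d x b + d x c"
      using triangle[OF m(1,2,3)] triangle[OF m(2) x m(3)] commute[OF m(2) x] by linarith
    then show ?thesis using c b bx by (intro bexI[of _ c]) auto
  qed
qed

lemma L_split:
  assumes x: "x \<in> M" and y: "y \<in> M" and z: "z \<in> M" and a: "a \<in> L x y"
  shows "\<exists>b \<in> L x z \<union> L z y. d a b \<le> 4 * h"
proof -
  obtain b where b: "b \<in> L x z \<union> L y z" "d a b \<le> h" using L_thin[OF x y z a] by blast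
  show ?thesis
  proof (cases "b \<in> L x z")
    case True
    then show ?thesis using b h_pos by (intro bexI[of _ b]) auto
  next
    case False
    then obtain c where c: "c \<in> L z y" "d b c \<le> 3 * h" using b L_swap[OF y z] by blast
    have m: "a \<in> M" "b \<in> M" "c \<in> M" using L_closed x y z a b c by blast+
    then show ?thesis using c b triangle[OF m] by (intro bexI[of _ c]) auto
  qed
qed

definition isometric :: "(real \<Rightarrow> 'x) \<Rightarrow> real \<Rightarrow> real \<Rightarrow> bool" where
  "isometric \<gamma> s t \<longleftrightarrow> s \<le> t \<and> \<gamma> ` {s..t} \<subseteq> M \<and>
    (\<forall>r \<in> {s..t}. \<forall>r' \<in> {s..t}. d (\<gamma> r) (\<gamma> r') = \<bar>r - r'\<bar>)"

lemma isometric_sub: "isometric \<gamma> s t \<Longrightarrow> s \<le> s' \<Longrightarrow> s' \<le> t' \<Longrightarrow> t' \<le> t \<Longrightarrow> isometric \<gamma> s' t'"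
  unfolding isometric_def by (auto simp: image_subset_iff)

lemma isometric_mem: "isometric \<gamma> s t \<Longrightarrow> s \<le> r \<Longrightarrow> r \<le> t \<Longrightarrow> \<gamma> r \<in> M"
  unfolding isometric_def by auto

text \<open>Halving the geodesic \<open>n\<close> times leaves pieces of length at most \<open>1\<close>, and each halving costs one
application of thinness. So the distance grows only with the logarithm of the length.\<close>

lemma L_near_geodesic_log:
  assumes "isometric \<gamma> s t" "t - s \<le> 2 ^ n" "a \<in> L (\<gamma> s) (\<gamma> t)"
  shows "\<exists>r \<in> {s..t}. d a (\<gamma> r) \<le> 4 * h * (real n + 1)"
  using assms
proof (induction n arbitrary: s t a)
  case 0
  have st: "s \<le> t" using 0(1) by (simp add: isometric_def)
  have m: "\<gamma> s \<in> M" "\<gamma> t \<in> M" using isometric_mem[OF 0(1)] st by auto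
  have am: "a \<in> M" using L_closed m 0(3) by blast
  have "d (\<gamma> s) (\<gamma> t) \<le> 1" using 0 st by (auto simp: isometric_def)
  then have "d (\<gamma> s) a \<le> h" using L_short m 0(3) by blast
  then have "d a (\<gamma> s) \<le> 4 * h" using commute[OF am m(1)] h_pos by simp
  then show ?case using st by (intro bexI[of _ s]) auto
next
  case (Suc n)
  define r where "r = (s + t) / 2"
  have st: "s \<le> r" "r \<le> t" "r - s \<le> 2 ^ n" "t - r \<le> 2 ^ n"
    using Suc.prems(1,2) by (auto simp: isometric_def r_def field_simps)
  have m: "\<gamma> s \<in> M" "\<gamma> t \<in> M" "\<gamma> r \<in> M" using isometric_mem[OF Suc.prems(1)] st by auto
  obtain b where b: "b \<in> L (\<gamma> s) (\<gamma> r) \<union> L (\<gamma> r) (\<gamma> t)" "d a b \<le> 4 * h"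
    using L_split[OF m Suc.prems(3)] by blast
  have "\<exists>q \<in> {s..t}. d b (\<gamma> q) \<le> 4 * h * (real n + 1)"
  proof (cases "b \<in> L (\<gamma> s) (\<gamma> r)")
    case True
    from Suc.IH[OF isometric_sub[OF Suc.prems(1)] st(3) True] st show ?thesis by fastforce
  next
    case False
    then have "b \<in> L (\<gamma> r) (\<gamma> t)" using b by blast
    from Suc.IH[OF isometric_sub[OF Suc.prems(1)] st(4) this] st show ?thesis by fastforce
  qed
  then obtain q where q: "q \<in> {s..t}" "d b (\<gamma> q) \<le> 4 * h * (real n + 1)" by blast
  have "a \<in> M" "b \<in> M" using L_closed m b Suc.prems(3) by blast+
  moreover have "\<gamma> q \<in> M" using isometric_mem[OF Suc.prems(1)] q by auto
  ultimately show ?case using triangle[of a b "\<gamma> q"] b q by (intro bexI[of _ q]) (auto simp: algebra_simps)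
qed

lemma exp_beats_linear: "\<exists>n0. \<forall>n \<ge> n0. c * (real n + 1) + e \<le> 2 ^ n"
proof -
  have "(\<lambda>n. c * (real n * (1 / 2) ^ n) + (c + e) * (1 / 2) ^ n) \<longlonglongrightarrow> c * 0 + (c + e) * 0"
    by (intro tendsto_intros LIMSEQ_power_zero powser_times_n_limit_0) simp_all
  moreover have "c * (real n * (1 / 2) ^ n) + (c + e) * (1 / 2) ^ n = (c * (real n + 1) + e) / 2 ^ n"
    for n by (simp add: field_simps)
  ultimately have "(\<lambda>n. (c * (real n + 1) + e) / 2 ^ n) \<longlonglongrightarrow> 0" by simp
  then have "\<forall>\<^sub>F n in sequentially. (c * (real n + 1) + e) / 2 ^ n < 1"
    by (rule order_tendstoD) simp
  then show ?thesis by (auto simp: eventually_sequentially field_simps intro: less_imp_le)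
qed

text \<open>The bound \<open>N\<close> on the length only serves to have some \<open>D\<close> to start from; the bound that is finally
reached does not depend on \<open>N\<close>.\<close>

definition near :: "real \<Rightarrow> real \<Rightarrow> bool" where
  "near N D \<longleftrightarrow> (\<forall>\<gamma> s t. \<forall>a \<in> L (\<gamma> s) (\<gamma> t). isometric \<gamma> s t \<and> t - s \<le> N \<longrightarrow>
    (\<exists>r \<in> {s..t}. d a (\<gamma> r) \<le> D))"

text \<open>A known bound \<open>D\<close> improves to one that is logarithmic in \<open>D\<close>. Cut the geodesic at distance about \<open>2 D\<close>
on both sides of a point \<open>\<gamma> r\<close> close to \<open>a\<close>. The guesses for the outer pieces stay within \<open>D\<close> of these
pieces, hence away from \<open>a\<close>. So \<open>a\<close> is close to the guess for the middle piece, whose length is about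
\<open>4 D\<close>, and the logarithmic bound applies to it.\<close>

lemma near_improve:
  assumes D: "near N D" "0 \<le> D" and n: "2 * (2 * D + 8 * h + 1) \<le> 2 ^ n"
  shows "near N (4 * h * (real n + 3))"
  unfolding near_def
proof (intro allI ballI impI)
  fix \<gamma> s t a
  assume a: "a \<in> L (\<gamma> s) (\<gamma> t)" and "isometric \<gamma> s t \<and> t - s \<le> N"
  then have iso: "isometric \<gamma> s t" and N: "t - s \<le> N" and st: "s \<le> t"
    by (auto simp: isometric_def)
  obtain r where r: "s \<le> r" "r \<le> t" "d a (\<gamma> r) \<le> D"
    using D(1) a iso N unfolding near_def by fastforce
  define R where "R = 2 * D + 8 * h + 1"
  have R: "0 < R" using D(2) h_pos by (simp add: R_def)
  define s' t' where "s' = max s (r - R)" and "t' = min t (r + R)"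
  have o: "s \<le> s'" "s' \<le> r" "r \<le> t'" "t' \<le> t" "t' - s' \<le> 2 ^ n"
    using r R n by (auto simp: s'_def t'_def R_def)
  have m: "\<gamma> s \<in> M" "\<gamma> s' \<in> M" "\<gamma> t' \<in> M" "\<gamma> t \<in> M" "\<gamma> r \<in> M"
    using isometric_mem[OF iso] o r by auto
  have am: "a \<in> M" using L_closed m a by blast
  obtain b where b: "b \<in> L (\<gamma> s) (\<gamma> s') \<union> L (\<gamma> s') (\<gamma> t') \<union> L (\<gamma> t') (\<gamma> t)" "d a b \<le> 8 * h"
  proof -
    obtain b where b: "b \<in> L (\<gamma> s) (\<gamma> s') \<union> L (\<gamma> s') (\<gamma> t)" "d a b \<le> 4 * h"
      using L_split[OF m(1,4,2) a] by blast
    show ?thesis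
    proof (cases "b \<in> L (\<gamma> s) (\<gamma> s')")
      case True then show ?thesis using that[of b] b h_pos by auto
    next
      case False
      then obtain c where c: "c \<in> L (\<gamma> s') (\<gamma> t') \<union> L (\<gamma> t') (\<gamma> t)" "d b c \<le> 4 * h"
        using b L_split[OF m(2,4,3), of b] by blast
      have "b \<in> M" "c \<in> M" using b c L_closed m by blast+
      then show ?thesis using that[of c] c b triangle[of a b c] am by auto
    qed
  qed
  have bm: "b \<in> M" using b L_closed m by blast
  have tri: "d a (\<gamma> q) \<le> 8 * h + d b (\<gamma> q)" if "q \<in> {s..t}" for q
    using triangle[OF am bm, of "\<gamma> q"] b(2) isometric_mem[OF iso] that by auto
  \<comment> \<open>The outer pieces are too far from \<open>\<gamma> r\<close> for \<open>b\<close> to be close to them, unless they are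
    degenerate.\<close>
  have far: False if q: "q \<in> {s..t}" "d b (\<gamma> q) \<le> D" "R \<le> \<bar>q - r\<bar>" for q
  proof -
    have qm: "\<gamma> q \<in> M" using isometric_mem[OF iso] q by auto
    have "\<bar>q - r\<bar> = d (\<gamma> q) (\<gamma> r)" using iso r q by (simp add: isometric_def)
    also have "\<dots> \<le> d a (\<gamma> q) + d a (\<gamma> r)"
      using triangle[OF qm am m(5)] commute[OF qm am] by simp
    also have "\<dots> < R" using tri[OF q(1)] q(2) r(3) by (simp add: R_def)
    finally show False using q(3) by simp
  qed
  have degenerate: "d a (\<gamma> q) \<le> 9 * h" if "q \<in> {s..t}" "b \<in> L (\<gamma> q) (\<gamma> q)" for q
  proof -
    have "\<gamma> q \<in> M" using isometric_mem[OF iso] that by auto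
    then show ?thesis
      using L_short[of "\<gamma> q" "\<gamma> q" b] zero commute[OF bm] tri[of q] that by auto
  qed
  have small: "9 * h \<le> 4 * h * (real n + 3)" using h_pos by (simp add: algebra_simps)
  consider "b \<in> L (\<gamma> s) (\<gamma> s')" | "b \<in> L (\<gamma> s') (\<gamma> t')" | "b \<in> L (\<gamma> t') (\<gamma> t)"
    using b by blast
  then show "\<exists>r \<in> {s..t}. d a (\<gamma> r) \<le> 4 * h * (real n + 3)"
  proof cases
    case 1
    have "isometric \<gamma> s s'" using isometric_sub[OF iso] o r by auto
    then obtain q where q: "q \<in> {s..s'}" "d b (\<gamma> q) \<le> D"
      using D(1) 1 o r N unfolding near_def by fastforce
    have "s' = s" using far[of q] q o r by (auto simp: s'_def max_def split: if_splits)
    then show ?thesis using degenerate[of s] 1 st small by (intro bexI[of _ s]) auto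
  next
    case 2
    obtain q where q: "q \<in> {s'..t'}" "d b (\<gamma> q) \<le> 4 * h * (real n + 1)"
      using L_near_geodesic_log[OF isometric_sub[OF iso] _ 2] o by fastforce
    then show ?thesis using tri[of q] o by (intro bexI[of _ q]) (auto simp: algebra_simps)
  next
    case 3
    have "isometric \<gamma> t' t" using isometric_sub[OF iso] o r by auto
    then obtain q where q: "q \<in> {t'..t}" "d b (\<gamma> q) \<le> D"
      using D(1) 3 o r N unfolding near_def by fastforce
    have "t' = t" using far[of q] q o r by (auto simp: t'_def min_def split: if_splits)
    then show ?thesis using degenerate[of t] 3 st small by (intro bexI[of _ t]) auto
  qed
qed

text \<open>The improvement \<open>near_improve\<close> turns the bound with index \<open>n + 1\<close> into the one with index \<open>n\<close> as soon
as \<open>2 ^ n\<close> exceeds a fixed linear function of \<open>n\<close>. Descending from the bound for length \<open>N\<close>, one ends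
at an index \<open>n0\<close> that is the same for all \<open>N\<close>.\<close>

lemma L_near_geodesic:
  "\<exists>K \<ge> 0. \<forall>\<gamma> s t. \<forall>a \<in> L (\<gamma> s) (\<gamma> t). isometric \<gamma> s t \<longrightarrow> (\<exists>r \<in> {s..t}. d a (\<gamma> r) \<le> K)"
proof -
  define D where "D n = 4 * h * (real n + 3)" for n
  have D_nonneg: "0 \<le> D n" for n using h_pos by (simp add: D_def)
  \<comment> \<open>The left-hand side is the one in \<open>near_improve\<close> for the bound \<open>D (Suc n)\<close>.\<close>
  obtain n0 where n0: "16 * h * (real n + 1) + (64 * h + 2) \<le> 2 ^ n" if "n \<ge> n0" for n
    using exp_beats_linear[of "16 * h" "64 * h + 2"] by blast
  have D_step: "near N (D n)" if "near N (D (Suc n))" "n \<ge> n0" for N n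
    using near_improve[OF that(1) D_nonneg, of n] n0[OF that(2)] h_pos
    by (simp add: D_def algebra_simps)
  have D_down: "near N (D n0)" if "near N (D (n0 + k))" for N k
    using that
  proof (induction k)
    case (Suc k)
    then show ?case using D_step[of N "n0 + k"] by simp
  qed simp
  have "near N (D n0)" for N
  proof -
    obtain n where n: "N < 2 ^ n" using real_arch_pow[of 2 N] by auto
    have "near N (D (n0 + n))"
      unfolding near_def
    proof (intro allI ballI impI)
      fix \<gamma> s t a assume a: "a \<in> L (\<gamma> s) (\<gamma> t)" "isometric \<gamma> s t \<and> t - s \<le> N"
      then obtain r where r: "r \<in> {s..t}" "d a (\<gamma> r) \<le> 4 * h * (real n + 1)"
        using L_near_geodesic_log[of \<gamma> s t n a] n by auto
      have "4 * h * (real n + 1) \<le> D (n0 + n)"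
        unfolding D_def using h_pos by (intro mult_left_mono) auto
      then show "\<exists>r \<in> {s..t}. d a (\<gamma> r) \<le> D (n0 + n)" using r by force
    qed
    then show ?thesis by (rule D_down)
  qed
  then show ?thesis unfolding near_def using D_nonneg[of n0] by (intro exI[of _ "D n0"]) blast
qed

lemma rtrancl_crossing:
  assumes "(a, b) \<in> R\<^sup>*" "Q a" "\<not> Q b"
  shows "\<exists>(u, v) \<in> R. Q u \<and> \<not> Q v"
  using assms by (induction rule: rtrancl_induct) auto

text \<open>A chain in \<open>L x y\<close> from near \<open>x\<close> to near \<open>y\<close> stays close to the geodesic by \<open>L_near_geodesic\<close>. Hence it
must jump across any given parameter \<open>r\<close>, and its points there are close to \<open>\<gamma> r\<close>.\<close>

lemma geodesic_near_L:
  "\<exists>K \<ge> 0. \<forall>\<gamma> s t. \<forall>r \<in> {s..t}. isometric \<gamma> s t \<longrightarrow> (\<exists>a \<in> L (\<gamma> s) (\<gamma> t). d (\<gamma> r) a \<le> K)"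
proof -
  obtain K where K: "0 \<le> K"
    "\<And>\<gamma> s t a. isometric \<gamma> s t \<Longrightarrow> a \<in> L (\<gamma> s) (\<gamma> t) \<Longrightarrow> \<exists>r \<in> {s..t}. d a (\<gamma> r) \<le> K"
    using L_near_geodesic by metis
  have "\<exists>a \<in> L (\<gamma> s) (\<gamma> t). d (\<gamma> r) a \<le> 3 * K + 3 * h"
    if iso: "isometric \<gamma> s t" and r: "r \<in> {s..t}" for \<gamma> s t r
  proof -
    have m: "\<gamma> q \<in> M" if "q \<in> {s..t}" for q using isometric_mem[OF iso] that by auto
    have st: "\<gamma> s \<in> M" "\<gamma> t \<in> M" using m r by auto
    have Lm: "u \<in> M" if "u \<in> L (\<gamma> s) (\<gamma> t)" for u using L_closed[OF st] that by blast
    have dist: "d (\<gamma> q) (\<gamma> q') = \<bar>q - q'\<bar>" if "q \<in> {s..t}" "q' \<in> {s..t}" for q q'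
      using iso that by (simp add: isometric_def)
    obtain a b where ab: "a \<in> L (\<gamma> s) (\<gamma> t)" "b \<in> L (\<gamma> s) (\<gamma> t)"
      "d (\<gamma> s) a \<le> h" "d (\<gamma> t) b \<le> h"
      "(a, b) \<in> {(u, v). u \<in> L (\<gamma> s) (\<gamma> t) \<and> v \<in> L (\<gamma> s) (\<gamma> t) \<and> d u v \<le> h}\<^sup>*"
      using L_chain[OF st] by blast
    define Q where "Q u \<longleftrightarrow> (\<exists>q \<in> {s..r}. d u (\<gamma> q) \<le> K + h)" for u
    have "Q a" unfolding Q_def using r ab K(1) commute[OF st(1) Lm] by (intro bexI[of _ s]) auto
    \<comment> \<open>The parameters of the points close to \<open>u\<close> and to \<open>v\<close> lie on both sides of \<open>r\<close>, which
      makes both close to \<open>r\<close>.\<close>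
    have between: "d (\<gamma> r) u \<le> 3 * K + 3 * h"
      if u: "u \<in> M" "q \<in> {s..r}" "d u (\<gamma> q) \<le> K + h"
        and v: "v \<in> M" "q' \<in> {r..t}" "d v (\<gamma> q') \<le> K" "d u v \<le> h" for u v q q'
    proof -
      have qm: "q \<in> {s..t}" "q' \<in> {s..t}" using u v r by auto
      have "q' - q = d (\<gamma> q) (\<gamma> q')" using dist qm u v by auto
      also have "\<dots> \<le> d u (\<gamma> q) + d u v + d v (\<gamma> q')"
        using triangle[OF m[OF qm(1)] u(1) m[OF qm(2)]] triangle[OF u(1) v(1) m[OF qm(2)]]
          commute[OF u(1) m[OF qm(1)]] by linarith
      finally have "q' - q \<le> 2 * K + 2 * h" using u v by simp
      moreover have "d (\<gamma> r) (\<gamma> q) = r - q" using dist r qm u by auto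
      ultimately have "d (\<gamma> r) (\<gamma> q) \<le> 2 * K + 2 * h" using v by auto
      then show ?thesis
        using triangle[OF m[OF r] m[OF qm(1)] u(1)] commute[OF u(1) m[OF qm(1)]] u(3) by linarith
    qed
    show ?thesis
    proof (cases "Q b")
      case True
      then obtain q where q: "q \<in> {s..r}" "d b (\<gamma> q) \<le> K + h" unfolding Q_def by blast
      have "d (\<gamma> r) b \<le> 3 * K + 3 * h"
        using between[OF Lm[OF ab(2)] q st(2), of t] r ab(4) commute[OF st(2) Lm[OF ab(2)]]
          zero[OF st(2)] K(1) by auto
      then show ?thesis using ab by blast
    next
      case False
      from rtrancl_crossing[where Q = Q, OF ab(5) \<open>Q a\<close> False] obtain u v where
        uv: "u \<in> L (\<gamma> s) (\<gamma> t)" "v \<in> L (\<gamma> s) (\<gamma> t)" "d u v \<le> h" "Q u" "\<not> Q v" by auto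
      obtain q where q: "q \<in> {s..r}" "d u (\<gamma> q) \<le> K + h" using uv unfolding Q_def by blast
      obtain q' where q': "q' \<in> {s..t}" "d v (\<gamma> q') \<le> K" using K(2)[OF iso uv(2)] by blast
      have "q' \<notin> {s..r}"
      proof
        assume "q' \<in> {s..r}"
        then have "Q v" unfolding Q_def using q' h_pos by (intro bexI[of _ q']) auto
        with uv show False by simp
      qed
      then have "d (\<gamma> r) u \<le> 3 * K + 3 * h"
        using between[OF Lm[OF uv(1)] q Lm[OF uv(2)], of q'] q' uv by auto
      then show ?thesis using uv by blast
    qed
  qed
  then show ?thesis using K(1) h_pos by (intro exI[of _ "3 * K + 3 * h"]) auto
qed

lemma geodesic_segment_isometric:
  assumes "geodesic_segment M d A x y" "x \<in> M" "y \<in> M"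
  obtains \<gamma> t where "isometric \<gamma> 0 t" "A = \<gamma> ` {0..t}" "\<gamma> 0 = x" "\<gamma> t = y"
proof -
  obtain \<gamma> where g: "geodesic_path M d \<gamma> x y" "A = \<gamma> ` {0..d x y}"
    using assms by (auto simp: geodesic_segment_def)
  have "0 \<le> d x y"
    using triangle[OF assms(2,3,2)] commute[OF assms(2,3)] zero[OF assms(2)] by simp
  then show ?thesis using that[of \<gamma> "d x y"] g by (auto simp: geodesic_path_def isometric_def)
qed

theorem triangles_thin:
  "\<exists>\<delta> > 0. \<forall>x y z A B C. geodesic_triangle M d x y z A B C \<longrightarrow> thin_triangle d \<delta> A B C"
proof -
  obtain K where K: "0 \<le> K"
    "\<And>\<gamma> s t a. isometric \<gamma> s t \<Longrightarrow> a \<in> L (\<gamma> s) (\<gamma> t) \<Longrightarrow> \<exists>r \<in> {s..t}. d a (\<gamma> r) \<le> K"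
    using L_near_geodesic by metis
  obtain K' where K': "0 \<le> K'"
    "\<And>\<gamma> s t r. isometric \<gamma> s t \<Longrightarrow> r \<in> {s..t} \<Longrightarrow> \<exists>a \<in> L (\<gamma> s) (\<gamma> t). d (\<gamma> r) a \<le> K'"
    using geodesic_near_L by metis
  define \<delta> where "\<delta> = K' + 7 * h + K"
  have seg_L: "\<exists>a \<in> L x y. d c a \<le> K'"
    if A: "geodesic_segment M d A x y" "c \<in> A" and m: "x \<in> M" "y \<in> M" for A x y c
  proof -
    obtain \<gamma> t where g: "isometric \<gamma> 0 t" "A = \<gamma> ` {0..t}" "\<gamma> 0 = x" "\<gamma> t = y"
      using geodesic_segment_isometric[OF A(1) m] .
    then show ?thesis using K'(2)[OF g(1)] A(2) by auto
  qed
  have L_seg: "\<exists>c \<in> A. d a c \<le> K + 3 * h"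
    if A: "geodesic_segment M d A x y \<or> geodesic_segment M d A y x" "a \<in> L x y"
      and m: "x \<in> M" "y \<in> M" for A x y a
  proof -
    have near: "\<exists>c \<in> A. d a c \<le> K"
      if A: "geodesic_segment M d A x y" "a \<in> L x y" and m: "x \<in> M" "y \<in> M" for x y a
    proof -
      obtain \<gamma> t where g: "isometric \<gamma> 0 t" "A = \<gamma> ` {0..t}" "\<gamma> 0 = x" "\<gamma> t = y"
        using geodesic_segment_isometric[OF A(1) m] .
      then show ?thesis using K(2)[OF g(1)] A(2) by auto
    qed
    show ?thesis
    proof (cases "geodesic_segment M d A x y")
      case True
      then show ?thesis using near[OF True A(2) m] h_pos by force
    next
      case False
      then have yx: "geodesic_segment M d A y x" using A by blast
      obtain b where b: "b \<in> L y x" "d a b \<le> 3 * h" using L_swap[OF m A(2)] by blast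
      obtain c where c: "c \<in> A" "d b c \<le> K" using near[OF yx b(1) m(2,1)] by blast
      have "c \<in> M" using c yx by (auto simp: geodesic_segment_def geodesic_path_def)
      moreover have "a \<in> M" "b \<in> M" using A b L_closed m by blast+
      ultimately show ?thesis using triangle[of a b c] b c by (intro bexI[of _ c]) auto
    qed
  qed
  have side: "\<exists>c' \<in> B \<union> C. d c c' \<le> \<delta>"
    if A: "geodesic_segment M d A x y" "c \<in> A" and m: "x \<in> M" "y \<in> M" "z \<in> M"
      and B: "geodesic_segment M d B y z \<or> geodesic_segment M d B z y"
      and C: "geodesic_segment M d C x z \<or> geodesic_segment M d C z x" for A B C x y z c
  proof -
    obtain a where a: "a \<in> L x y" "d c a \<le> K'" using seg_L[OF A m(1,2)] by blast
    obtain b where b: "b \<in> L x z \<union> L z y" "d a b \<le> 4 * h" using L_split[OF m a(1)] by blast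
    have "\<exists>c' \<in> B \<union> C. d b c' \<le> K + 3 * h"
      using b L_seg[of C x z b] L_seg[of B z y b] B C m by blast
    then obtain c' where c': "c' \<in> B \<union> C" "d b c' \<le> K + 3 * h" by blast
    have "c \<in> M" "a \<in> M" "b \<in> M" using A a b L_closed m
      by (auto simp: geodesic_segment_def geodesic_path_def)
    moreover have "c' \<in> M" using c' B C by (auto simp: geodesic_segment_def geodesic_path_def)
    ultimately show ?thesis
      using triangle[of c a c'] triangle[of a b c'] a b c'
      by (intro bexI[of _ c']) (auto simp: \<delta>_def)
  qed
  have "thin_triangle d \<delta> A B C" if T: "geodesic_triangle M d x y z A B C" for x y z A B C
  proof -
    have s: "geodesic_segment M d A x y" "geodesic_segment M d B y z" "geodesic_segment M d C x z"
      using T by (auto simp: geodesic_triangle_def)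
    then have m: "x \<in> M" "y \<in> M" "z \<in> M" by (auto simp: geodesic_segment_def geodesic_path_def)
    show ?thesis
      unfolding thin_triangle_def
      using side[OF s(1) _ m, of _ B C] side[OF s(2) _ m(2,3,1), of _ C A]
        side[OF s(3) _ m(1,3,2), of _ B A] s by (metis Un_commute)
  qed
  moreover have "0 < \<delta>" using K K' h_pos by (simp add: \<delta>_def)
  ultimately show ?thesis by blast
qed

end

section \<open>Geodesics between vertices of a Cayley graph\<close>

context generated_group
begin

text \<open>The vertices on the geodesics from \<open>g\<close> to \<open>h\<close>, expressed by distances alone.\<close>

definition between :: "'a \<Rightarrow> 'a \<Rightarrow> 'a set" where
  "between g h = {z \<in> carrier G. word_dist G S g z + word_dist G S z h = word_dist G S g h}"

lemma between_closed: "between g h \<subseteq> carrier G"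
  by (auto simp: between_def)

lemma word_dist_self: "g \<in> carrier G \<Longrightarrow> word_dist G S g g = 0"
  using word_dist_zero by simp

lemma endpoints_between:
  assumes "g \<in> carrier G" "h \<in> carrier G"
  shows "g \<in> between g h" "h \<in> between g h"
  using assms by (simp_all add: between_def word_dist_self)

lemma geodesic_walk:
  assumes "a \<in> carrier G" "b \<in> carrier G" "word_length G S (inv a \<otimes> b) = n"
  shows "\<exists>v. v 0 = a \<and> v n = b \<and> (\<forall>i. v i \<in> carrier G) \<and>
    (\<forall>i < n. cayley_adj G S (v i) (v (Suc i)))"
  using assms
proof (induction n arbitrary: a)
  case 0
  then have "word_dist G S a b = 0" by (simp add: word_dist_def)
  then have "a = b" using 0 word_dist_zero by blast
  then show ?case using 0 by (intro exI[of _ "\<lambda>_. a"]) simp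
next
  case (Suc n)
  have ab: "inv a \<otimes> b \<in> carrier G" using Suc.prems by simp
  obtain ws where ws: "spells ws (inv a \<otimes> b)" "length ws = Suc n"
    using word_length_attained[OF ab] Suc.prems(3) by metis
  then obtain c cs where cs: "ws = c # cs" by (cases ws) auto
  define k where "k = foldr (mult G) cs \<one>"
  have c: "c \<in> letters" "c \<in> carrier G" and k: "spells cs k" "k \<in> carrier G" "inv a \<otimes> b = c \<otimes> k"
    using ws cs letters_closed foldr_closed[of cs] by (auto simp: spells_def k_def)
  have k_eq: "inv (a \<otimes> c) \<otimes> b = k"
    using Suc.prems c k by (simp add: inv_mult_group m_assoc) (simp flip: m_assoc)
  have "word_length G S c \<le> 1" using word_length_le[of "[c]" c] c by (simp add: spells_def)
  moreover have "word_length G S (c \<otimes> k) \<le> word_length G S c + word_length G S k"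
    using word_length_mult c k by blast
  moreover have "word_length G S k \<le> n" using word_length_le[OF k(1)] ws cs by simp
  ultimately have len: "word_length G S (inv (a \<otimes> c) \<otimes> b) = n"
    using k_eq k(3) Suc.prems(3) by simp
  obtain v where v: "v 0 = a \<otimes> c" "v n = b" "\<forall>i. v i \<in> carrier G"
    "\<forall>i < n. cayley_adj G S (v i) (v (Suc i))"
    using Suc.IH[OF _ Suc.prems(2) len] Suc.prems(1) c by auto
  have "a \<noteq> a \<otimes> c" using len Suc.prems(3) by auto
  moreover have "inv a \<otimes> (a \<otimes> c) = c" using Suc.prems(1) c by (simp flip: m_assoc)
  ultimately have "cayley_adj G S a (a \<otimes> c)"
    using Suc.prems(1) c by (simp add: cayley_adj_def letters_def)
  then have "cayley_adj G S (case_nat a v i) (case_nat a v (Suc i))" if "i < Suc n" for i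
    using that v by (cases i) auto
  then show ?case using v Suc.prems(1)
    by (intro exI[of _ "case_nat a v"]) (auto split: nat.splits)
qed

lemma walk_closed:
  assumes "\<And>i. i < n \<Longrightarrow> cayley_adj G S (v i) (v (Suc i))" "v 0 \<in> carrier G" "i \<le> n"
  shows "v i \<in> carrier G"
  using assms by (cases i) (auto simp: cayley_adj_def Suc_le_eq)

lemma walk_dist_le:
  assumes v: "\<And>i. i < n \<Longrightarrow> cayley_adj G S (v i) (v (Suc i))" "v 0 \<in> carrier G"
    and ij: "i \<le> j" "j \<le> n"
  shows "word_dist G S (v i) (v j) \<le> real (j - i)"
  using ij
proof (induction j rule: dec_induct)
  case base
  then show ?case using word_dist_self walk_closed[of n v, OF v] by simp
next
  case (step j)
  then show ?case
    using word_dist_triangle[of "v i" "v j" "v (Suc j)"] word_dist_adj[OF v(1), of j]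
      walk_closed[of n v, OF v] by auto
qed

lemma between_chain:
  assumes a: "a \<in> carrier G" and b: "b \<in> carrier G"
  shows "(a, b) \<in> {(u, v). u \<in> between a b \<and> v \<in> between a b \<and> word_dist G S u v \<le> 1}\<^sup>*"
    (is "_ \<in> ?R\<^sup>*")
proof -
  define n where "n = word_length G S (inv a \<otimes> b)"
  obtain v where v: "v 0 = a" "v n = b" "\<forall>i. v i \<in> carrier G"
    "\<forall>i < n. cayley_adj G S (v i) (v (Suc i))"
    using geodesic_walk[OF a b] n_def by metis
  have mem: "v i \<in> between a b" if "i \<le> n" for i
  proof -
    have "word_dist G S a (v i) \<le> real i" "word_dist G S (v i) b \<le> real (n - i)"
      using walk_dist_le[of n v 0 i] walk_dist_le[of n v i n] v that by auto
    moreover have "word_dist G S a b = real n" by (simp add: word_dist_def n_def)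
    moreover have "word_dist G S a b \<le> word_dist G S a (v i) + word_dist G S (v i) b"
      using word_dist_triangle a b v by blast
    ultimately show ?thesis using v that by (simp add: between_def of_nat_diff)
  qed
  have "(a, v i) \<in> ?R\<^sup>*" if "i \<le> n" for i
    using that
  proof (induction i)
    case (Suc i)
    then have "(v i, v (Suc i)) \<in> ?R" using mem v word_dist_adj[of "v i" "v (Suc i)"] by auto
    then show ?case using Suc by (meson Suc_leD rtrancl_into_rtrancl)
  qed (simp add: v)
  then show ?thesis using v by auto
qed

lemma word_dist_translate:
  assumes "g \<in> carrier G" "a \<in> carrier G" "b \<in> carrier G"
  shows "word_dist G S (g \<otimes> a) (g \<otimes> b) = word_dist G S a b"
proof -
  have "inv (g \<otimes> a) \<otimes> (g \<otimes> b) = inv a \<otimes> (inv g \<otimes> (g \<otimes> b))"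
    using assms by (simp add: inv_mult_group m_assoc)
  also have "inv g \<otimes> (g \<otimes> b) = b" using assms by (simp flip: m_assoc)
  finally show ?thesis by (simp add: word_dist_def)
qed

lemma between_translate:
  assumes "g \<in> carrier G" "a \<in> carrier G" "b \<in> carrier G" "z \<in> between a b"
  shows "g \<otimes> z \<in> between (g \<otimes> a) (g \<otimes> b)"
  using assms by (auto simp: between_def word_dist_translate)

text \<open>The path through the vertices \<open>v 0, v 1, \<dots>\<close> that takes unit time for each edge.\<close>

definition walk_path :: "(nat \<Rightarrow> 'a) \<Rightarrow> real \<Rightarrow> 'a \<Rightarrow> real" where
  "walk_path v t = edge_point (v (nat \<lfloor>t\<rfloor>)) (v (Suc (nat \<lfloor>t\<rfloor>))) (t - real (nat \<lfloor>t\<rfloor>))"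

lemma walk_path_nat: "walk_path v (real i) = vertex (v i)"
  by (auto simp: walk_path_def edge_point_def)

lemma walk_path_edge:
  assumes "real i \<le> t" "t \<le> real i + 1"
  shows "walk_path v t = edge_point (v i) (v (Suc i)) (t - real i)"
proof (cases "t = real (Suc i)")
  case True
  then show ?thesis using walk_path_nat[of v "Suc i"] by (auto simp: edge_point_def)
next
  case False
  then have "\<lfloor>t\<rfloor> = int i" using assms by (intro floor_unique) auto
  then show ?thesis by (simp add: walk_path_def)
qed

lemma walk_geodesic:
  assumes v: "\<And>i. i < n \<Longrightarrow> cayley_adj G S (v i) (v (Suc i))" "v 0 \<in> carrier G"
    and n: "word_dist G S (v 0) (v n) = real n"
  shows "geodesic_path (cayley_graph G S) (cayley_dist G S) (walk_path v) (vertex (v 0)) (vertex (v n))"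
proof -
  let ?d = "cayley_dist G S" and ?X = "cayley_graph G S"
  have vc: "v i \<in> carrier G" if "i \<le> n" for i
    using that v by (cases i) (auto simp: cayley_adj_def Suc_le_eq)
  have edge_mem: "walk_path v t \<in> ?X \<and> ?d (walk_path v s) (walk_path v t) = \<bar>s - t\<bar>"
    if "i < n" "real i \<le> s" "s \<le> real i + 1" "real i \<le> t" "t \<le> real i + 1" for i s t
  proof -
    have e: "geodesic_path ?X ?d (edge_point (v i) (v (Suc i))) (vertex (v i)) (vertex (v (Suc i)))"
      by (rule edge_isometric[OF v(1)[OF that(1)]])
    have "?d (vertex (v i)) (vertex (v (Suc i))) = 1"
      using cayley_dist_vertex vc[of i] vc[of "Suc i"] word_dist_adj[OF v(1)[OF that(1)]] that by auto
    then show ?thesis using e that walk_path_edge[of i s v] walk_path_edge[of i t v]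
      by (auto simp: geodesic_path_def)
  qed
  have edge: "\<exists>i < n. real i \<le> t \<and> t \<le> real i + 1" if "0 \<le> t" "t \<le> real n" "0 < n" for t
  proof (cases "t = real n")
    case True
    then show ?thesis using that by (intro exI[of _ "n - 1"]) auto
  next
    case False
    then have "nat \<lfloor>t\<rfloor> < n" using that by (simp add: nat_less_iff floor_less_iff)
    then show ?thesis using that by (intro exI[of _ "nat \<lfloor>t\<rfloor>"]) (auto; linarith)
  qed
  have mem: "walk_path v t \<in> ?X" if "0 \<le> t" "t \<le> real n" for t
  proof (cases "n = 0")
    case True
    then show ?thesis using that walk_path_nat[of v 0] vertex_in_cayley_graph vc[of 0] by simp
  next
    case False
    then show ?thesis using edge[OF that] edge_mem by blast
  qed
  have lip: "?d (walk_path v s) (walk_path v t) \<le> t - s" if st: "0 \<le> s" "s \<le> t" "t \<le> real n" for s t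
  proof (cases "n = 0")
    case True
    then have "s = 0" "t = 0" using st by auto
    then show ?thesis using cayley_dist_zero[of "walk_path v 0" "walk_path v 0"] mem[of 0] by auto
  next
    case False
    then obtain i j where i: "i < n" "real i \<le> s" "s \<le> real i + 1"
      and j: "j < n" "real j \<le> t" "t \<le> real j + 1"
      using edge[of s] edge[of t] st by auto
    consider "j \<le> i" | "i < j" by linarith
    then show ?thesis
    proof cases
      case 1
      show ?thesis
      proof (cases "i = j")
        case True
        then show ?thesis using edge_mem[of i s t] i j st by auto
      next
        case False
        then have "real j + 1 \<le> real i" using 1 by simp
        then have "s = t" using i j st by linarith
        then show ?thesis using mem[of s] st cayley_dist_zero[of "walk_path v s" "walk_path v s"] by simp
      qed
    next
      case 2
      let ?p = "walk_path v (real (Suc i))" and ?q = "walk_path v (real j)"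
      have m: "walk_path v s \<in> ?X" "walk_path v t \<in> ?X" "?p \<in> ?X" "?q \<in> ?X"
        using mem st i j by auto
      have "?d ?p ?q \<le> real (j - Suc i)"
        using walk_dist_le[of n v "Suc i" j] v 2 j vc unfolding walk_path_nat by (simp add: cayley_dist_vertex)
      moreover have "?d (walk_path v s) ?p = real (Suc i) - s" using edge_mem[of i s "real (Suc i)"] i by auto
      moreover have "?d ?q (walk_path v t) = t - real j" using edge_mem[of j "real j" t] j by auto
      moreover have "real (j - Suc i) = real j - real (Suc i)" using 2 by simp
      ultimately show ?thesis
        using cayley_dist_triangle[OF m(1,3,2)] cayley_dist_triangle[OF m(3,4,2)] by linarith
    qed
  qed
  have total: "?d (vertex (v 0)) (vertex (v n)) = real n" using n vc cayley_dist_vertex by simp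
  \<comment> \<open>A path of length \<open>n\<close> that does not stretch distances cannot shrink them either if its
    endpoints are at distance \<open>n\<close>.\<close>
  have iso: "?d (walk_path v s) (walk_path v t) = t - s" if st: "0 \<le> s" "s \<le> t" "t \<le> real n" for s t
  proof -
    have m: "walk_path v 0 \<in> ?X" "walk_path v s \<in> ?X" "walk_path v t \<in> ?X" "walk_path v (real n) \<in> ?X"
      using mem st by auto
    have "real n = ?d (walk_path v 0) (walk_path v (real n))"
      using total walk_path_nat[of v 0] by (simp add: walk_path_nat)
    then show ?thesis
      using cayley_dist_triangle[OF m(1,2,4)] cayley_dist_triangle[OF m(2,3,4)]
        lip[of 0 s] lip[of t "real n"] lip[OF st] st by auto
  qed
  have "?d (walk_path v s) (walk_path v t) = \<bar>s - t\<bar>" if "s \<in> {0..real n}" "t \<in> {0..real n}" for s t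
    using that iso[of s t] iso[of t s] cayley_dist_commute[of "walk_path v s" "walk_path v t"] mem
    by (cases "s \<le> t") auto
  then show ?thesis
    unfolding geodesic_path_def total
    using mem vertex_in_cayley_graph vc walk_path_nat[of v 0] walk_path_nat[of v n] by auto
qed

lemma geodesic_segment_through:
  assumes a: "a \<in> carrier G" and b: "b \<in> carrier G" and z: "z \<in> between a b"
  shows "\<exists>A. geodesic_segment (cayley_graph G S) (cayley_dist G S) A (vertex a) (vertex b) \<and> vertex z \<in> A"
proof -
  have zc: "z \<in> carrier G" using z between_closed by blast
  define m n where "m = word_length G S (inv a \<otimes> z)" and "n = word_length G S (inv z \<otimes> b)"
  have mn: "word_dist G S a b = real (m + n)" using z by (simp add: between_def word_dist_def m_def n_def)
  obtain v where v: "v 0 = a" "v m = z" "\<forall>i. v i \<in> carrier G"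
    "\<forall>i < m. cayley_adj G S (v i) (v (Suc i))"
    using geodesic_walk[OF a zc] m_def by metis
  obtain w where w: "w 0 = z" "w n = b" "\<forall>i. w i \<in> carrier G"
    "\<forall>i < n. cayley_adj G S (w i) (w (Suc i))"
    using geodesic_walk[OF zc b] n_def by metis
  define u where "u i = (if i \<le> m then v i else w (i - m))" for i
  have u: "u 0 = a" "u m = z" "u (m + n) = b" using v w by (auto simp: u_def)
  have adj: "cayley_adj G S (u i) (u (Suc i))" if "i < m + n" for i
  proof (cases "i < m")
    case True
    then show ?thesis using v by (simp add: u_def)
  next
    case False
    then have "u i = w (i - m)" "u (Suc i) = w (Suc (i - m))" using v w
      by (auto simp: u_def Suc_diff_le)
    then show ?thesis using w False that by simp
  qed
  have g: "geodesic_path (cayley_graph G S) (cayley_dist G S) (walk_path u) (vertex a) (vertex b)"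
    using walk_geodesic[of "m + n" u] adj u mn a by simp
  have "vertex z = walk_path u (real m)" by (simp add: walk_path_nat u)
  moreover have "real m \<in> {0..cayley_dist G S (vertex a) (vertex b)}"
    using cayley_dist_vertex[OF a b] mn by simp
  ultimately show ?thesis using g unfolding geodesic_segment_def by blast
qed

text \<open>A point in the interior of an edge lies on the geodesic between that edge's endpoints, and the one
through which the geodesic enters is at distance at most \<open>1\<close>.\<close>

lemma geodesic_point_near_between:
  assumes a: "a \<in> carrier G" and b: "b \<in> carrier G"
    and A: "geodesic_segment (cayley_graph G S) (cayley_dist G S) A (vertex a) (vertex b)" and x: "x \<in> A"
  shows "\<exists>z \<in> between a b. cayley_dist G S x (vertex z) \<le> 1"
proof -
  let ?d = "cayley_dist G S" and ?X = "cayley_graph G S"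
  obtain \<gamma> t where g: "geodesic_path ?X ?d \<gamma> (vertex a) (vertex b)"
    and t: "0 \<le> t" "t \<le> word_dist G S a b" "x = \<gamma> t"
    using A x cayley_dist_vertex[OF a b] by (auto simp: geodesic_segment_def)
  have xX: "x \<in> ?X" and ax: "?d (vertex a) x = t" and xb: "?d x (vertex b) = word_dist G S a b - t"
  proof -
    have "?d (\<gamma> r) (\<gamma> r') = \<bar>r - r'\<bar>" "\<gamma> r \<in> ?X"
      if "r \<in> {0..word_dist G S a b}" "r' \<in> {0..word_dist G S a b}" for r r'
      using g that cayley_dist_vertex[OF a b] by (auto simp: geodesic_path_def)
    from this[of 0 t] this[of t "word_dist G S a b"] this[of t t]
    show "x \<in> ?X" "?d (vertex a) x = t" "?d x (vertex b) = word_dist G S a b - t"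
      using g t cayley_dist_vertex[OF a b] by (auto simp: geodesic_path_def)
  qed
  have near: "?d x (vertex z) \<le> 1 - x z" if "z \<in> supp x" for z
  proof -
    have "z \<in> carrier G" using that point_supp(3)[OF xX] by blast
    moreover have "vertex z z = 1" by (simp add: vertex_def)
    ultimately show ?thesis
      using dist_le[OF xX vertex_in_cayley_graph[of z] that, of z] word_dist_self[of z]
      by (simp del: cayley_dist_vertex)
  qed
  have vX: "vertex a \<in> ?X" "vertex b \<in> ?X" using a b vertex_in_cayley_graph by auto
  show ?thesis
  proof (cases "\<exists>z. supp x = {z}")
    case True
    then obtain z where z: "supp x = {z}" by blast
    have zc: "z \<in> carrier G" using z point_supp(3)[OF xX] by blast
    have "x z = 1" using point_single[OF xX z] .
    then have "?d x (vertex z) = 0"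
      using near[of z] z cayley_dist_nonneg[OF xX vertex_in_cayley_graph[OF zc]] by simp
    then have "x = vertex z" using cayley_dist_zero[OF xX vertex_in_cayley_graph[OF zc]] by simp
    then have "z \<in> between a b" using ax xb zc a b by (simp add: between_def cayley_dist_vertex)
    then show ?thesis using \<open>?d x (vertex z) = 0\<close> by force
  next
    case False
    have ne: "supp (vertex a) \<noteq> supp x" "supp x \<noteq> supp (vertex b)" using False by auto
    have one: "vertex a a = 1" "vertex b b = 1" by (simp_all add: vertex_def)
    obtain g where g: "g \<in> supp x" "t = word_dist G S a g + (1 - x g)"
    proof -
      obtain a' g where "a' \<in> supp (vertex a)" "g \<in> supp x"
        "?d (vertex a) x = (1 - vertex a a') + word_dist G S a' g + (1 - x g)"
        using diff_supp_dist_attained[OF vX(1) xX ne(1)] .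
      then show ?thesis using that ax one by simp
    qed
    obtain h where h: "h \<in> supp x" "word_dist G S a b - t = (1 - x h) + word_dist G S h b"
    proof -
      obtain h b' where "h \<in> supp x" "b' \<in> supp (vertex b)"
        "?d x (vertex b) = (1 - x h) + word_dist G S h b' + (1 - vertex b b')"
        using diff_supp_dist_attained[OF xX vX(2) ne(2)] .
      then show ?thesis using that xb one by simp
    qed
    have c: "g \<in> carrier G" "h \<in> carrier G" using g h point_supp(3)[OF xX] by blast+
    have "g \<in> between a b"
    proof (cases "g = h")
      case True
      then have "x g = 1" using g h point_coord[OF xX g(1)] word_dist_triangle[OF a c(1) b] by simp
      then show ?thesis using point_one[OF xX g(1)] False by blast
    next
      case False
      then have "x g + x h = 1" "word_dist G S g h = 1" using point_other[OF xX g(1) h(1)] by auto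
      then show ?thesis
        using g h c word_dist_triangle[OF a c(1) b] word_dist_triangle[OF c b]
        by (simp add: between_def)
    qed
    moreover have "?d x (vertex g) \<le> 1" using near[OF g(1)] point_coord[OF xX g(1)] by simp
    ultimately show ?thesis by blast
  qed
qed

text \<open>Thinness of geodesic triangles in the Cayley graph, reduced to vertices; the extra \<open>1\<close> is the cost of
moving from a point of an edge to a vertex.\<close>

lemma between_thin_if_triangle_thin:
  assumes c: "a \<in> carrier G" "b \<in> carrier G" "c \<in> carrier G"
    and thin: "\<And>A B C. geodesic_triangle (cayley_graph G S) (cayley_dist G S)
      (vertex a) (vertex b) (vertex c) A B C \<Longrightarrow> thin_triangle (cayley_dist G S) \<delta> A B C"
    and z: "z \<in> between a b"
  shows "\<exists>w \<in> between a c \<union> between b c. word_dist G S z w \<le> \<delta> + 1"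
proof -
  let ?d = "cayley_dist G S" and ?X = "cayley_graph G S"
  obtain A where A: "geodesic_segment ?X ?d A (vertex a) (vertex b)" "vertex z \<in> A"
    using geodesic_segment_through[OF c(1,2) z] by blast
  obtain B C where BC: "geodesic_segment ?X ?d B (vertex b) (vertex c)"
    "geodesic_segment ?X ?d C (vertex a) (vertex c)"
    using geodesic_segment_through endpoints_between(1) c by meson
  obtain x where x: "x \<in> B \<union> C" "?d (vertex z) x \<le> \<delta>"
    using thin[of A B C] A BC unfolding geodesic_triangle_def thin_triangle_def by blast
  obtain w where w: "w \<in> between a c \<union> between b c" "?d x (vertex w) \<le> 1"
    using x geodesic_point_near_between[OF c(2,3) BC(1)] geodesic_point_near_between[OF c(1,3) BC(2)]
    by blast
  have "z \<in> carrier G" "w \<in> carrier G" using z w between_closed by blast+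
  moreover have "x \<in> ?X" using x BC by (auto simp: geodesic_segment_def geodesic_path_def)
  ultimately have "word_dist G S z w \<le> \<delta> + 1"
    using cayley_dist_triangle[of "vertex z" x "vertex w"] vertex_in_cayley_graph x w
    by (simp add: cayley_dist_vertex)
  then show ?thesis using w by blast
qed

end

section \<open>Normal forms in pregroups with property (P6)\<close>

context pregroup
begin

abbreviation base :: "'p set" where "base \<equiv> pregroup_base P"

lemma defd_closed:
  assumes "(u, v) \<in> defd P" shows "u \<in> carrier P" "v \<in> carrier P"
  using assms defd_subset by auto

lemma cancel_left:
  assumes "(u, v) \<in> defd P"
  shows "(pinv P u, u \<otimes> v) \<in> defd P" "pinv P u \<otimes> (u \<otimes> v) = v"
  using P4[of "pinv P u" u v] P1[of v] P2[of u] assms defd_closed[OF assms] by auto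

lemma cancel_right:
  assumes "(u, v) \<in> defd P"
  shows "(u \<otimes> v, pinv P v) \<in> defd P" "u \<otimes> v \<otimes> pinv P v = u"
  using P4[of u v "pinv P v"] P1[of u] P2[of v] assms defd_closed[OF assms] by auto

lemma pinv_pinv:
  assumes u: "u \<in> carrier P" shows "pinv P (pinv P u) = u"
proof -
  have "(pinv P u, u) \<in> defd P" "pinv P u \<otimes> u = \<one>" using P2[OF u] by auto
  then show ?thesis
    using cancel_left[of "pinv P u" u] P1[OF pinv_closed[OF pinv_closed[OF u]]] by simp
qed

lemma base_closed: "b \<in> base \<Longrightarrow> b \<in> carrier P"
  by (simp add: pregroup_base_def)

lemma base_defd:
  "b \<in> base \<Longrightarrow> z \<in> carrier P \<Longrightarrow> (z, b) \<in> defd P"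
  "b \<in> base \<Longrightarrow> z \<in> carrier P \<Longrightarrow> (b, z) \<in> defd P"
  by (simp_all add: pregroup_base_def)

lemma base_one: "\<one> \<in> base"
  using P1 one_closed by (simp add: pregroup_base_def)

lemma base_inv:
  assumes b: "b \<in> base" shows "pinv P b \<in> base"
proof -
  have "(z, pinv P b) \<in> defd P \<and> (pinv P b, z) \<in> defd P" if z: "z \<in> carrier P" for z
    using P3[OF base_defd(2)[OF b pinv_closed[OF z]]] P3[OF base_defd(1)[OF b pinv_closed[OF z]]]
      pinv_pinv[OF z] by simp
  then show ?thesis using pinv_closed base_closed[OF b] by (simp add: pregroup_base_def)
qed

lemma base_mult:
  assumes b: "b \<in> base" and c: "c \<in> base" shows "b \<otimes> c \<in> base"
proof -
  note bc = base_defd(1)[OF c base_closed[OF b]]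
  have "(z, b \<otimes> c) \<in> defd P \<and> (b \<otimes> c, z) \<in> defd P" if z: "z \<in> carrier P" for z
    using P4[OF base_defd(1)[OF b z] bc] P4[OF bc base_defd(2)[OF c z]] base_defd[OF b]
      base_defd[OF c] mult_closed base_defd(1)[OF b z] base_defd(2)[OF c z] by blast
  then show ?thesis using mult_closed[OF bc] by (simp add: pregroup_base_def)
qed

text \<open>Elements of \<open>base\<close> can be moved freely across products: multiplying by them affects neither
definedness nor membership in \<open>base\<close>. Here and in the next two lemmas this comes from (P4), used for
\<open>b\<close> and for its inverse.\<close>

lemma base_left:
  assumes b: "b \<in> base" and u: "u \<in> carrier P"
  shows "(b \<otimes> u, v) \<in> defd P \<longleftrightarrow> (u, v) \<in> defd P"
    and "(u, v) \<in> defd P \<Longrightarrow> (b \<otimes> u) \<otimes> v = b \<otimes> (u \<otimes> v)"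
    and "b \<otimes> u \<in> base \<longleftrightarrow> u \<in> base"
    and "pinv P b \<otimes> (b \<otimes> u) = u" and "b \<otimes> (pinv P b \<otimes> u) = u"
proof -
  have *: "(b \<otimes> u, v) \<in> defd P \<and> (b \<otimes> u) \<otimes> v = b \<otimes> (u \<otimes> v)"
    if "(u, v) \<in> defd P" "b \<in> base" "u \<in> carrier P" for b u v
    using P4[OF base_defd(2)[OF that(2,3)] that(1)] base_defd(2)[OF that(2) mult_closed[OF that(1)]]
    by blast
  have inv: "pinv P b \<otimes> (b \<otimes> u) = u" if "b \<in> base" "u \<in> carrier P" for b u
    using cancel_left[OF base_defd(2)[OF that]] by blast
  show "pinv P b \<otimes> (b \<otimes> u) = u" by (rule inv[OF b u])
  show "b \<otimes> (pinv P b \<otimes> u) = u"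
    using inv[OF base_inv[OF b] u] pinv_pinv[OF base_closed[OF b]] by simp
  have bu: "b \<otimes> u \<in> carrier P" by (rule mult_closed[OF base_defd(2)[OF b u]])
  show "(b \<otimes> u, v) \<in> defd P \<longleftrightarrow> (u, v) \<in> defd P"
    using *[OF _ b u] *[OF _ base_inv[OF b] bu] inv[OF b u] by metis
  show "(u, v) \<in> defd P \<Longrightarrow> (b \<otimes> u) \<otimes> v = b \<otimes> (u \<otimes> v)" using *[OF _ b u] by blast
  show "b \<otimes> u \<in> base \<longleftrightarrow> u \<in> base" using base_mult[OF b] base_mult[OF base_inv[OF b]] inv[OF b u] by metis
qed

lemma base_right:
  assumes b: "b \<in> base" and v: "v \<in> carrier P"
  shows "(u, v \<otimes> b) \<in> defd P \<longleftrightarrow> (u, v) \<in> defd P"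
    and "(u, v) \<in> defd P \<Longrightarrow> u \<otimes> (v \<otimes> b) = (u \<otimes> v) \<otimes> b"
    and "v \<otimes> b \<in> base \<longleftrightarrow> v \<in> base"
    and "v \<otimes> b \<otimes> pinv P b = v"
proof -
  have *: "(u, v \<otimes> b) \<in> defd P \<and> (u \<otimes> v) \<otimes> b = u \<otimes> (v \<otimes> b)"
    if "(u, v) \<in> defd P" "b \<in> base" "v \<in> carrier P" for b u v
    using P4[OF that(1) base_defd(1)[OF that(2,3)]] base_defd(1)[OF that(2) mult_closed[OF that(1)]]
    by blast
  have inv: "v \<otimes> b \<otimes> pinv P b = v" if "b \<in> base" "v \<in> carrier P" for b v
    using cancel_right[OF base_defd(1)[OF that]] by blast
  show "v \<otimes> b \<otimes> pinv P b = v" by (rule inv[OF b v])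
  have vb: "v \<otimes> b \<in> carrier P" by (rule mult_closed[OF base_defd(1)[OF b v]])
  show "(u, v \<otimes> b) \<in> defd P \<longleftrightarrow> (u, v) \<in> defd P"
    using *[OF _ b v] *[OF _ base_inv[OF b] vb] inv[OF b v] by metis
  show "(u, v) \<in> defd P \<Longrightarrow> u \<otimes> (v \<otimes> b) = (u \<otimes> v) \<otimes> b" using *[OF _ b v] by metis
  show "v \<otimes> b \<in> base \<longleftrightarrow> v \<in> base"
    using base_mult[OF _ b] base_mult[OF _ base_inv[OF b]] inv[OF b v] by metis
qed

lemma base_middle:
  assumes b: "b \<in> base" and u: "u \<in> carrier P" and v: "v \<in> carrier P"
  shows "(u \<otimes> b, v) \<in> defd P \<longleftrightarrow> (u, b \<otimes> v) \<in> defd P"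
    and "(u \<otimes> b, v) \<in> defd P \<Longrightarrow> (u \<otimes> b) \<otimes> v = u \<otimes> (b \<otimes> v)"
  using P4[OF base_defd(1)[OF b u] base_defd(2)[OF b v]] by auto

lemma not_defd_imp_not_base:
  assumes "(u, v) \<notin> defd P" "u \<in> carrier P" "v \<in> carrier P" shows "u \<notin> base" "v \<notin> base"
  using assms base_defd by blast+

lemma reduced_iff:
  "reduced_product P us \<longleftrightarrow> set us \<subseteq> carrier P \<and> successively (\<lambda>u v. (u, v) \<notin> defd P) us"
  by (simp add: reduced_product_def successively_conv_nth)

text \<open>The interleaving moves of Stallings' normal form theorem. Under (P6) only elements of \<open>base\<close> can
interleave a reduced product, so no others are admitted.\<close>

inductive slide :: "'p list \<Rightarrow> 'p list \<Rightarrow> bool" where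
  "b \<in> base \<Longrightarrow> u \<in> carrier P \<Longrightarrow> v \<in> carrier P \<Longrightarrow>
    slide (xs @ u # v # ys) (xs @ (u \<otimes> b) # (pinv P b \<otimes> v) # ys)"

lemma slide_sym: "slide us vs \<Longrightarrow> slide vs us"
proof (induction rule: slide.induct)
  case (1 b u v xs ys)
  let ?c = "pinv P b"
  have c: "?c \<in> base" by (rule base_inv[OF 1(1)])
  have uv: "u \<otimes> b \<in> carrier P" "?c \<otimes> v \<in> carrier P"
    using mult_closed base_defd(1)[OF 1(1,2)] base_defd(2)[OF c 1(3)] by auto
  have "u \<otimes> b \<otimes> ?c = u" "pinv P ?c \<otimes> (?c \<otimes> v) = v"
    using base_right(4)[OF 1(1,2)] base_left(4)[OF c 1(3)] by auto
  then show ?case using slide.intros[OF c uv, of xs ys] by simp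
qed

lemma slide_reduced: "slide us vs \<Longrightarrow> reduced_product P us \<Longrightarrow> reduced_product P vs"
proof (induction rule: slide.induct)
  case (1 b u v xs ys)
  let ?c = "pinv P b"
  have c: "?c \<in> base" by (rule base_inv[OF 1(1)])
  have uv: "u \<otimes> b \<in> carrier P" "?c \<otimes> v \<in> carrier P"
    using mult_closed base_defd(1)[OF 1(1,2)] base_defd(2)[OF c 1(3)] by auto
  have "(u \<otimes> b, ?c \<otimes> v) \<in> defd P \<longleftrightarrow> (u, v) \<in> defd P"
    using base_middle(1)[OF c uv(1) 1(3)] base_right(4)[OF 1(1,2)] by simp
  then show ?case
    using 1 uv base_right(1)[OF 1(1,2)] base_left(1)[OF c 1(3)]
    by (auto simp: reduced_iff successively_append_iff successively_Cons)
qed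

lemma slides_reduced: "slide\<^sup>*\<^sup>* us vs \<Longrightarrow> reduced_product P us \<Longrightarrow> reduced_product P vs"
  by (induction rule: rtranclp_induct) (auto intro: slide_reduced)

lemma slides_sym: "slide\<^sup>*\<^sup>* us vs \<Longrightarrow> slide\<^sup>*\<^sup>* vs us"
  by (induction rule: rtranclp_induct) (auto intro: converse_rtranclp_into_rtranclp slide_sym)

end

locale rigid_pregroup = pregroup P for P :: "'p pregroup" (structure) +
  assumes P6: "\<And>x y a. x \<in> carrier P \<Longrightarrow> y \<in> carrier P \<Longrightarrow> a \<in> carrier P \<Longrightarrow>
      (x, y) \<notin> defd P \<Longrightarrow> (x, a) \<in> defd P \<Longrightarrow> (pinv P a, y) \<in> defd P \<Longrightarrow>
      a \<in> pregroup_base P"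
begin

text \<open>If \<open>(pu)v\<close> were defined, \<open>(pu)\<^sup>-\<^sup>1\<close> would be an element that can be moved between \<open>u\<close> and \<open>v\<close>, as
\<open>u(pu)\<^sup>-\<^sup>1 = p\<^sup>-\<^sup>1\<close>; so it would lie in \<open>base\<close> by (P6). Thus merging two factors of a product keeps it
reduced unless the merged factor lies in \<open>base\<close>.\<close>

lemma merge_left:
  assumes "(u, v) \<notin> defd P" "v \<in> carrier P" "(p, u) \<in> defd P" "p \<otimes> u \<notin> base"
  shows "(p \<otimes> u, v) \<notin> defd P"
proof
  assume d: "(p \<otimes> u, v) \<in> defd P"
  let ?a = "pinv P (p \<otimes> u)"
  have pu: "p \<in> carrier P" "u \<in> carrier P" "p \<otimes> u \<in> carrier P"
    using defd_closed assms(3) mult_closed by auto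
  have eq: "?a = pinv P u \<otimes> pinv P p" "(pinv P u, pinv P p) \<in> defd P" using P3[OF assms(3)] by auto
  have "(u, ?a) \<in> defd P" using cancel_left(1)[OF eq(2)] eq(1) pinv_pinv[OF pu(2)] by simp
  then have "?a \<in> base" using P6[of u v ?a] assms pu d pinv_pinv[OF pu(3)] pinv_closed by simp
  then show False using base_inv[of ?a] pinv_pinv[OF pu(3)] assms(4) by simp
qed

lemma merge_right:
  assumes "(u, v) \<notin> defd P" "u \<in> carrier P" "(v, w) \<in> defd P" "v \<otimes> w \<notin> base"
  shows "(u, v \<otimes> w) \<notin> defd P"
proof
  assume d: "(u, v \<otimes> w) \<in> defd P"
  have vw: "v \<in> carrier P" "w \<in> carrier P" "v \<otimes> w \<in> carrier P"
    using defd_closed assms(3) mult_closed by auto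
  have eq: "pinv P (v \<otimes> w) = pinv P w \<otimes> pinv P v" "(pinv P w, pinv P v) \<in> defd P"
    using P3[OF assms(3)] by auto
  have "(pinv P (v \<otimes> w), v) \<in> defd P" using cancel_right(1)[OF eq(2)] eq(1) pinv_pinv[OF vw(1)] by simp
  then have "v \<otimes> w \<in> base" using P6[of u v "v \<otimes> w"] assms vw d by simp
  then show False using assms(4) by simp
qed

text \<open>Left multiplication of reduced products by \<open>p\<close>. The unit of \<open>P\<close> is represented by \<open>[\<one>]\<close>, and \<open>push\<close>
is meant for nonempty lists; on these, at most two factors change, because a factor in \<open>base\<close> is
absorbed by the next one, which leaves the next one incomposable with its right neighbour.\<close>

fun push :: "'p \<Rightarrow> 'p list \<Rightarrow> 'p list" where
  "push p [] = [p]"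
| "push p [u] = (if (p, u) \<in> defd P then [p \<otimes> u] else [p, u])"
| "push p (u # v # us) =
    (if (p, u) \<notin> defd P then p # u # v # us
     else if p \<otimes> u \<in> base then (p \<otimes> u \<otimes> v) # us
     else (p \<otimes> u) # v # us)"

lemma push_not_Nil [simp]: "push p us \<noteq> []"
  by (cases "(p, us)" rule: push.cases) auto

lemma push_reduced:
  assumes "p \<in> carrier P" "reduced_product P us"
  shows "reduced_product P (push p us)"
  using assms
proof (cases "(p, us)" rule: push.cases)
  case (3 q u v ws)
  have uv: "u \<in> carrier P" "v \<in> carrier P" "(u, v) \<notin> defd P" using assms 3 by (auto simp: reduced_iff)
  show ?thesis
    using assms 3 uv merge_left[OF uv(3,2)] base_defd(2)[OF _ uv(2)] base_left(1)[OF _ uv(2)]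
    by (auto simp: reduced_iff successively_Cons mult_closed)
qed (auto simp: reduced_iff mult_closed)

lemma push_slide:
  assumes "slide us vs" "reduced_product P us" "p \<in> carrier P"
  shows "slide\<^sup>*\<^sup>* (push p us) (push p vs)"
  using assms(1)
proof cases
  case (1 b u v xs ys)
  have slideI: "slide\<^sup>*\<^sup>* (zs @ u' # v # ys) (zs @ (u' \<otimes> b) # (pinv P b \<otimes> v) # ys)"
    if "u' \<in> carrier P" for zs u'
    using slide.intros[OF 1(3) that 1(5)] by blast
  have slideI': "slide\<^sup>*\<^sup>* (zs @ u # v # ys) (zs @ (u \<otimes> b) # (pinv P b \<otimes> v) # ys)" for zs
    by (rule slideI[OF 1(4)])
  consider "xs = []" | x where "xs = [x]" | x y zs where "xs = x # y # zs" by (metis list.exhaust)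
  then show ?thesis
  proof cases
    case 1
    note us = \<open>us = xs @ u # v # ys\<close>[unfolded 1, simplified]
      and vs = \<open>vs = xs @ u \<otimes> b # pinv P b \<otimes> v # ys\<close>[unfolded 1, simplified]
    note b = \<open>b \<in> base\<close> and uc = \<open>u \<in> carrier P\<close> and vc = \<open>v \<in> carrier P\<close>
    have d: "(p, u \<otimes> b) \<in> defd P \<longleftrightarrow> (p, u) \<in> defd P" by (rule base_right(1)[OF b uc])
    show ?thesis
    proof (cases "(p, u) \<in> defd P")
      case False
      then show ?thesis using slideI'[of "[p]"] d by (simp add: us vs)
    next
      case True
      have pu: "p \<otimes> u \<in> carrier P" by (rule mult_closed[OF True])
      have eq: "p \<otimes> (u \<otimes> b) = p \<otimes> u \<otimes> b" by (rule base_right(2)[OF b uc True])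
      have iff: "p \<otimes> u \<otimes> b \<in> base \<longleftrightarrow> p \<otimes> u \<in> base" by (rule base_right(3)[OF b pu])
      show ?thesis
      proof (cases "p \<otimes> u \<in> base")
        case True
        have bv: "pinv P b \<otimes> v \<in> carrier P" by (rule mult_closed[OF base_defd(2)[OF base_inv[OF b] vc]])
        have "p \<otimes> u \<otimes> b \<otimes> (pinv P b \<otimes> v) = p \<otimes> u \<otimes> v"
          using base_middle(2)[OF b pu bv] base_left(5)[OF b vc] True iff base_defd(2)[OF _ bv] by simp
        then show ?thesis using True \<open>(p, u) \<in> defd P\<close> d eq iff by (simp add: us vs)
      next
        case False
        then show ?thesis using slideI[OF pu, of "[]"] \<open>(p, u) \<in> defd P\<close> d eq iff by (simp add: us vs)
      qed
    qed
  next
    case (2 x)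
    then have xu: "x \<in> carrier P" using 1 assms by (auto simp: reduced_iff)
    show ?thesis
    proof (cases "(p, x) \<in> defd P \<and> p \<otimes> x \<in> base")
      case True
      let ?w = "p \<otimes> x"
      have wu: "?w \<otimes> u \<in> carrier P" using mult_closed[OF base_defd(2)] True \<open>u \<in> carrier P\<close> by blast
      have "?w \<otimes> (u \<otimes> b) = ?w \<otimes> u \<otimes> b"
        using base_right(2)[OF \<open>b \<in> base\<close> \<open>u \<in> carrier P\<close>] base_defd(2) True \<open>u \<in> carrier P\<close> by blast
      then show ?thesis using slideI[OF wu, of "[]"] True by (simp add: 1(1,2) 2)
    next
      case False
      then show ?thesis
        using slideI'[of "[p, x]"] slideI'[of "[p \<otimes> x]"] by (auto simp: 1(1,2) 2)
    qed
  next
    case (3 x y zs)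
    then show ?thesis
      using slideI'[of "p # x # y # zs"] slideI'[of "(p \<otimes> x \<otimes> y) # zs"] slideI'[of "(p \<otimes> x) # y # zs"]
      by (auto simp: 1(1,2))
  qed
qed

lemma push_slides:
  assumes "slide\<^sup>*\<^sup>* us vs" "reduced_product P us" "p \<in> carrier P"
  shows "slide\<^sup>*\<^sup>* (push p us) (push p vs)"
  using assms(1)
proof (induction rule: rtranclp_induct)
  case (step vs ws)
  have "slide\<^sup>*\<^sup>* (push p vs) (push p ws)"
    by (rule push_slide[OF step(2) slides_reduced[OF step(1) assms(2)] assms(3)])
  with step.IH show ?case by (rule rtranclp_trans)
qed simp

lemma push_one:
  assumes "us \<noteq> []" "reduced_product P us"
  shows "push \<one> us = us"
proof (cases "(\<one>, us)" rule: push.cases)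
  case (3 q u v ws)
  then show ?thesis using assms P1[of u] not_defd_imp_not_base(1)[of u v] by (auto simp: reduced_iff)
qed (use assms P1 in \<open>auto simp: reduced_iff\<close>)

lemma slideI:
  assumes "b \<in> base" "u \<in> carrier P" "v \<in> carrier P"
  shows "slide\<^sup>*\<^sup>* (u # b \<otimes> v # ys) (u \<otimes> b # v # ys)"
proof -
  have bv: "b \<otimes> v \<in> carrier P" using mult_closed base_defd(2) assms by blast
  show ?thesis using slide.intros[OF assms(1,2) bv, of "[]" ys] base_left(4)[OF assms(1,3)] by auto
qed

text \<open>Up to sliding, \<open>push\<close> respects the relations of the universal group, so that the universal group acts
on classes of reduced products. This is van der Waerden's method for the uniqueness of normal forms.
Only two cases do not give equal lists: \<open>p\<close> cannot be multiplied with what pushing \<open>q\<close> has put in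
front, although \<open>p \<otimes> q\<close> is defined. Then the two results are related by sliding an element of \<open>base\<close>:
either \<open>q\<close>, which lies there by (P6), or the product of \<open>q\<close> with the first factor.\<close>

lemma push_mult:
  assumes pq: "(p, q) \<in> defd P" and us: "us \<noteq> []" "reduced_product P us"
  shows "slide\<^sup>*\<^sup>* (push p (push q us)) (push (p \<otimes> q) us)"
proof -
  obtain v vs where v: "us = v # vs" using us(1) by (cases us) auto
  have c: "p \<in> carrier P" "q \<in> carrier P" "v \<in> carrier P" "p \<otimes> q \<in> carrier P"
    using us v defd_closed[OF pq] mult_closed[OF pq] by (auto simp: reduced_iff)
  have next_undef: "v' \<in> carrier P" "(v, v') \<notin> defd P" if "vs = v' # vs'" for v' vs'
    using us v that by (auto simp: reduced_iff)
  show ?thesis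
  proof (cases "(q, v) \<in> defd P")
    case False
    have q: "push q us = q # v # vs" using False v by (cases vs) auto
    show ?thesis
    proof (cases "p \<otimes> q \<in> base")
      case True
      have "p \<otimes> q \<otimes> v \<notin> base"
        using base_left(3)[OF True c(3)] not_defd_imp_not_base(2)[OF False c(2,3)] by simp
      then have "push (p \<otimes> q) us = (p \<otimes> q \<otimes> v) # vs"
        using base_defd(2)[OF True c(3)] v by (cases vs) auto
      then show ?thesis using q True pq by simp
    next
      case nb: False
      have "(p \<otimes> q, v) \<notin> defd P" by (rule merge_left[OF False c(3) pq nb])
      then have "push (p \<otimes> q) us = (p \<otimes> q) # v # vs" using v by (cases vs) auto
      then show ?thesis using q nb pq by simp
    qed
  next
    case True
    let ?w = "q \<otimes> v"
    have w: "?w \<in> carrier P" by (rule mult_closed[OF True])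
    have d: "(p \<otimes> q, v) \<in> defd P \<longleftrightarrow> (p, ?w) \<in> defd P" "(p, ?w) \<in> defd P \<Longrightarrow> p \<otimes> q \<otimes> v = p \<otimes> ?w"
      using P4[OF pq True] by auto
    show ?thesis
    proof (cases "?w \<in> base \<and> vs \<noteq> []")
      case False
      then have q: "push q us = ?w # vs" using v True by (cases vs) auto
      show ?thesis
      proof (cases "(p, ?w) \<in> defd P")
        case True
        then show ?thesis using q v d by (cases vs) auto
      next
        case undef: False
        then have "push p (?w # vs) = p # ?w # vs" "push (p \<otimes> q) us = p \<otimes> q # v # vs"
          using d v by (cases vs; auto)+
        moreover have "q \<in> base"
          using P6[OF c(1) w c(2) undef pq] cancel_left(1)[OF True] by simp
        ultimately show ?thesis using slideI[OF _ c(1,3)] q by simp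
      qed
    next
      case wB: True
      then obtain v' vs' where v': "vs = v' # vs'" by (cases vs) auto
      note n = next_undef[OF v']
      have v'_nb: "v' \<notin> base" using not_defd_imp_not_base(2)[OF n(2) c(3) n(1)] .
      have q: "push q us = (?w \<otimes> v') # vs'" using v v' True wB by simp
      have pw: "(p, ?w) \<in> defd P" "p \<otimes> ?w \<in> carrier P" using base_defd(1) wB c mult_closed by blast+
      have e: "p \<otimes> q \<otimes> v = p \<otimes> ?w" "(p \<otimes> q, v) \<in> defd P" using d pw by auto
      have m: "(p \<otimes> ?w, v') \<in> defd P \<longleftrightarrow> (p, ?w \<otimes> v') \<in> defd P"
        "(p \<otimes> ?w, v') \<in> defd P \<Longrightarrow> p \<otimes> ?w \<otimes> v' = p \<otimes> (?w \<otimes> v')"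
        using base_middle[OF _ c(1) n(1)] wB by auto
      show ?thesis
      proof (cases "p \<otimes> ?w \<in> base")
        case True
        have pd: "(p, ?w \<otimes> v') \<in> defd P" using m(1) base_defd(2)[OF True n(1)] by simp
        have pe: "p \<otimes> (?w \<otimes> v') = p \<otimes> ?w \<otimes> v'" using m pd by simp
        have "p \<otimes> (?w \<otimes> v') \<notin> base" using base_left(3)[OF True n(1)] v'_nb pe by simp
        then have "push p ((?w \<otimes> v') # vs') = (p \<otimes> (?w \<otimes> v')) # vs'"
          using pd by (cases vs') auto
        then show ?thesis using q v v' True e pe by simp
      next
        case False
        have "(p \<otimes> q \<otimes> v, v') \<notin> defd P"
          by (rule merge_left[OF n(2,1) e(2)]) (use False e in simp)
        then have "(p, ?w \<otimes> v') \<notin> defd P" using m e by simp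
        then have "push p ((?w \<otimes> v') # vs') = p # ?w \<otimes> v' # vs'" by (cases vs') auto
        moreover have "push (p \<otimes> q) us = p \<otimes> ?w # v' # vs'" using v v' e False by simp
        ultimately show ?thesis using slideI[OF _ c(1) n(1)] wB q by simp
      qed
    qed
  qed
qed

definition letter :: "bool \<times> 'p \<Rightarrow> 'p" where
  "letter = (\<lambda>(e, x). if e then x else pinv P x)"

definition act :: "(bool \<times> 'p) list \<Rightarrow> 'p list \<Rightarrow> 'p list" where
  "act w us = foldr (\<lambda>l. push (letter l)) w us"

lemma act_simps [simp]: "act [] us = us" "act (l # w) us = push (letter l) (act w us)"
  "act (u @ w) us = act u (act w us)"
  by (simp_all add: act_def)

lemma letter_closed: "x \<in> carrier P \<Longrightarrow> letter (e, x) \<in> carrier P"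
  by (simp add: letter_def pinv_closed)

lemma act_reduced:
  assumes "w \<in> words (carrier P)" "us \<noteq> []" "reduced_product P us"
  shows "act w us \<noteq> []" "reduced_product P (act w us)"
  using assms by (induction w) (auto simp: words_def intro!: push_reduced letter_closed)

lemma act_slides:
  assumes "w \<in> words (carrier P)" "slide\<^sup>*\<^sup>* us vs" "us \<noteq> []" "reduced_product P us"
  shows "slide\<^sup>*\<^sup>* (act w us) (act w vs)"
  using assms
proof (induction w)
  case (Cons l w)
  have w: "w \<in> words (carrier P)" "letter l \<in> carrier P"
    using Cons.prems(1) letter_closed by (cases l; auto simp: words_def)+
  then show ?case using Cons push_slides[OF Cons.IH act_reduced(2)] by simp
qed simp

lemma word_cong_act:
  assumes "(u, w) \<in> word_cong (carrier P) (pregroup_relations P)" "us \<noteq> []" "reduced_product P us"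
  shows "slide\<^sup>*\<^sup>* (act u us) (act w us)"
  using assms
proof (induction arbitrary: us rule: word_cong.induct)
  case (sym u v)
  then show ?case by (blast intro: slides_sym)
next
  case (trans u v w)
  then show ?case by (blast intro: rtranclp_trans)
next
  case (cong u v a b)
  have u: "u \<in> words (carrier P)" using word_cong_words[OF cong(1)] by blast
  note b = act_reduced[OF cong(3) cong.prems]
  show ?case using act_slides[OF cong(2) cong.IH[OF b] act_reduced[OF u b]] by simp
next
  case (cancel x e)
  let ?p = "letter (e, x)" and ?q = "letter (\<not> e, x)"
  have "(?p, ?q) \<in> defd P" "?p \<otimes> ?q = \<one>"
    using P2[OF cancel(1)] by (auto simp: letter_def)
  then show ?case using push_mult[of ?p ?q us] cancel push_one by simp
next
  case (rel r s)
  then show ?case using push_mult by (auto simp: pregroup_relations_def letter_def)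
qed simp

lemma act_reduced_word:
  assumes "us \<noteq> []" "reduced_product P us"
  shows "act (map (Pair True) us) [\<one>] = us"
  using assms
proof (induction us)
  case (Cons u us)
  show ?case
  proof (cases us)
    case Nil
    then show ?thesis using Cons P1[of u] by (auto simp: letter_def reduced_iff)
  next
    case (Cons v vs)
    then have "act (map (Pair True) us) [\<one>] = us" "(u, v) \<notin> defd P"
      using Cons.IH Cons.prems by (auto simp: reduced_iff)
    then show ?thesis using Cons by (cases vs) (auto simp: letter_def)
  qed
qed simp

text \<open>Acting on \<open>[\<one>]\<close>, the word of a reduced product builds up this very product; so words of the same element
lead to the same class.\<close>

theorem normal_form:
  assumes us: "us \<noteq> []" "reduced_product P us" and vs: "vs \<noteq> []" "reduced_product P vs"
    and cong: "(map (Pair True) us, map (Pair True) vs) \<in> word_cong (carrier P) (pregroup_relations P)"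
  shows "slide\<^sup>*\<^sup>* us vs"
proof -
  have "reduced_product P [\<one>]" using one_closed by (simp add: reduced_iff)
  from word_cong_act[OF cong _ this] show ?thesis
    using act_reduced_word us vs by simp
qed

end

section \<open>Reduced products in the Cayley graph\<close>

locale group_of_pregroup = pg: rigid_pregroup P + generated_group G S
  for P :: "'p pregroup" and G :: "('a, 'b) monoid_scheme" (structure) and S :: "'a set" +
  fixes \<phi> :: "(bool \<times> 'p) list set \<Rightarrow> 'a" and \<iota> :: "'p \<Rightarrow> 'a"
  assumes iso: "\<phi> \<in> iso (universal_group P) G"
    and embedding: "\<And>p. p \<in> carrier P \<Longrightarrow> \<iota> p = \<phi> (canonical_map P p)"
begin

abbreviation word_class :: "(bool \<times> 'p) list \<Rightarrow> (bool \<times> 'p) list set" where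
  "word_class w \<equiv> word_cong (carrier P) (pregroup_relations P) `` {w}"

lemma carrier_universal: "carrier (universal_group P) = words (carrier P) // word_cong (carrier P) (pregroup_relations P)"
  by (simp add: universal_group_def presented_group_def)

lemma word_class_closed: "w \<in> words (carrier P) \<Longrightarrow> word_class w \<in> carrier (universal_group P)"
  by (simp add: carrier_universal quotientI)

lemma \<phi>_closed: "w \<in> words (carrier P) \<Longrightarrow> \<phi> (word_class w) \<in> carrier G"
  using iso word_class_closed by (auto simp: iso_def hom_def)

lemma \<phi>_append:
  assumes "u \<in> words (carrier P)" "w \<in> words (carrier P)"
  shows "\<phi> (word_class (u @ w)) = \<phi> (word_class u) \<otimes> \<phi> (word_class w)"
proof -
  have "\<phi> (word_class u \<otimes>\<^bsub>universal_group P\<^esub> word_class w) = \<phi> (word_class u) \<otimes> \<phi> (word_class w)"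
    using iso word_class_closed assms by (simp add: iso_def hom_def)
  then show ?thesis by (simp add: universal_group_def presented_group_mult_class[OF assms])
qed

lemma \<phi>_eq: "(u, w) \<in> word_cong (carrier P) (pregroup_relations P) \<Longrightarrow> \<phi> (word_class u) = \<phi> (word_class w)"
  using equiv_class_eq[OF equiv_word_cong] by metis

lemma \<phi>_Nil: "\<phi> (word_class []) = \<one>"
proof -
  have nil: "[] \<in> words (carrier P)" by (simp add: words_def)
  have "\<phi> (word_class []) \<otimes> \<phi> (word_class []) = \<phi> (word_class [])"
    using \<phi>_append[OF nil nil] by simp
  then show ?thesis using \<phi>_closed[OF nil] l_cancel_one by blast
qed

lemma \<iota>_eq: "p \<in> carrier P \<Longrightarrow> \<iota> p = \<phi> (word_class [(True, p)])"
  by (simp add: embedding canonical_map_def)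

lemma \<iota>_closed [simp]: "p \<in> carrier P \<Longrightarrow> \<iota> p \<in> carrier G"
  by (simp add: \<iota>_eq \<phi>_closed words_def)

lemma \<iota>_mult:
  assumes "(p, q) \<in> defd P" shows "\<iota> (p \<otimes>\<^bsub>P\<^esub> q) = \<iota> p \<otimes> \<iota> q"
proof -
  have c: "p \<in> carrier P" "q \<in> carrier P" "p \<otimes>\<^bsub>P\<^esub> q \<in> carrier P"
    using pg.defd_closed[OF assms] pg.mult_closed[OF assms] by auto
  have "([(True, p), (True, q)], [(True, p \<otimes>\<^bsub>P\<^esub> q)]) \<in> word_cong (carrier P) (pregroup_relations P)"
    by (rule word_cong.rel) (use assms c in \<open>auto simp: pregroup_relations_def words_def\<close>)
  from \<phi>_eq[OF this] show ?thesis
    using \<phi>_append[of "[(True, p)]" "[(True, q)]"] c by (simp add: \<iota>_eq words_def)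
qed

lemma \<iota>_one: "\<iota> \<one>\<^bsub>P\<^esub> = \<one>"
proof -
  have "\<iota> \<one>\<^bsub>P\<^esub> \<otimes> \<iota> \<one>\<^bsub>P\<^esub> = \<iota> \<one>\<^bsub>P\<^esub>"
    using \<iota>_mult[of "\<one>\<^bsub>P\<^esub>" "\<one>\<^bsub>P\<^esub>"] pg.P1[OF pg.one_closed] by simp
  then show ?thesis using \<iota>_closed[OF pg.one_closed] l_cancel_one by blast
qed

lemma \<phi>_letter:
  assumes "x \<in> carrier P" shows "\<phi> (word_class [(e, x)]) = \<iota> (pg.letter (e, x))"
proof (cases e)
  case True
  then show ?thesis using assms by (simp add: \<iota>_eq pg.letter_def)
next
  case False
  have "([(False, x), (\<not> False, x)], []) \<in> word_cong (carrier P) (pregroup_relations P)"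
    by (rule word_cong.cancel[OF assms])
  from \<phi>_eq[OF this] have "\<phi> (word_class [(False, x)]) \<otimes> \<iota> x = \<one>"
    using \<phi>_append[of "[(False, x)]" "[(True, x)]"] assms \<phi>_Nil by (simp add: \<iota>_eq words_def)
  moreover have "\<iota> (pinv P x) \<otimes> \<iota> x = \<one>"
    using \<iota>_mult[of "pinv P x" x] pg.P2[OF assms] \<iota>_one by simp
  ultimately have "\<phi> (word_class [(False, x)]) = \<iota> (pinv P x)"
    using assms \<phi>_closed[of "[(False, x)]"] pg.pinv_closed[OF assms]
      inv_equality[of "\<phi> (word_class [(False, x)])" "\<iota> x"] inv_equality[of "\<iota> (pinv P x)" "\<iota> x"]
    by (simp add: words_def)
  then show ?thesis using False by (simp add: pg.letter_def)
qed

definition val :: "'p list \<Rightarrow> 'a" where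
  "val us = foldr (\<lambda>u g. \<iota> u \<otimes> g) us \<one>"

lemma val_simps [simp]: "val [] = \<one>" "val (u # us) = \<iota> u \<otimes> val us"
  by (simp_all add: val_def)

lemma val_closed [simp]: "set us \<subseteq> carrier P \<Longrightarrow> val us \<in> carrier G"
  by (induction us) auto

lemma val_append:
  "set us \<subseteq> carrier P \<Longrightarrow> set vs \<subseteq> carrier P \<Longrightarrow> val (us @ vs) = val us \<otimes> val vs"
  by (induction us) (auto simp: m_assoc)

lemma reduced_closed: "reduced_product P us \<Longrightarrow> set us \<subseteq> carrier P"
  by (simp add: reduced_product_def)

lemma val_push:
  assumes "p \<in> carrier P" "reduced_product P us"
  shows "val (pg.push p us) = \<iota> p \<otimes> val us"
proof (cases "(p, us)" rule: pg.push.cases)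
  case (3 q u v ws)
  have c: "u \<in> carrier P" "v \<in> carrier P" "set ws \<subseteq> carrier P" using 3 reduced_closed[OF assms(2)] by auto
  then show ?thesis
    using 3 assms by (auto simp: \<iota>_mult m_assoc pg.base_defd)
qed (use assms reduced_closed[OF assms(2)] in \<open>auto simp: \<iota>_mult m_assoc\<close>)

lemma val_act:
  assumes "w \<in> words (carrier P)" "reduced_product P us" "us \<noteq> []"
  shows "val (pg.act w us) = \<phi> (word_class w) \<otimes> val us"
  using assms(1)
proof (induction w)
  case Nil
  then show ?case using \<phi>_Nil reduced_closed[OF assms(2)] by simp
next
  case (Cons l w)
  obtain e x where l: "l = (e, x)" by (cases l)
  have w: "w \<in> words (carrier P)" "[l] \<in> words (carrier P)" "x \<in> carrier P"
    using Cons.prems l by (auto simp: words_def)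
  have "val (pg.act (l # w) us) = \<iota> (pg.letter l) \<otimes> val (pg.act w us)"
    using val_push[OF _ pg.act_reduced(2)[OF w(1) assms(3,2)]] pg.letter_closed[OF w(3)] l by simp
  then show ?case
    using Cons.IH[OF w(1)] \<phi>_append[OF w(2,1)] \<phi>_letter[OF w(3)] l reduced_closed[OF assms(2)]
      \<phi>_closed w by (simp add: m_assoc pg.letter_closed)
qed

text \<open>Let a word for \<open>g\<close> act on the reduced product \<open>[\<one>]\<close>; the value is multiplied by \<open>g\<close>.\<close>

lemma reduced_exists:
  assumes "g \<in> carrier G"
  shows "\<exists>us. us \<noteq> [] \<and> reduced_product P us \<and> val us = g"
proof -
  have "g \<in> \<phi> ` carrier (universal_group P)" using assms iso by (simp add: iso_def bij_betw_def)
  then obtain w where w: "w \<in> words (carrier P)" "g = \<phi> (word_class w)"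
    by (auto simp: carrier_universal elim!: quotientE)
  have one: "reduced_product P [\<one>\<^bsub>P\<^esub>]" using pg.one_closed by (simp add: pg.reduced_iff)
  have "val (pg.act w [\<one>\<^bsub>P\<^esub>]) = g" using val_act[OF w(1) one] \<iota>_one \<phi>_closed w by simp
  then show ?thesis using pg.act_reduced[OF w(1) _ one] by blast
qed

lemma val_word:
  "set us \<subseteq> carrier P \<Longrightarrow> val us = \<phi> (word_class (map (Pair True) us))"
proof (induction us)
  case (Cons u us)
  then have "[(True, u)] \<in> words (carrier P)" "map (Pair True) us \<in> words (carrier P)"
    by (auto simp: words_def)
  from \<phi>_append[OF this] show ?case using Cons by (simp add: \<iota>_eq)
qed (simp add: \<phi>_Nil)

lemma reduced_unique:
  assumes us: "us \<noteq> []" "reduced_product P us" and vs: "vs \<noteq> []" "reduced_product P vs"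
    and eq: "val us = val vs"
  shows "pg.slide\<^sup>*\<^sup>* us vs"
proof (rule pg.normal_form[OF us vs])
  let ?u = "map (Pair True) us" and ?v = "map (Pair True) vs"
  have w: "?u \<in> words (carrier P)" "?v \<in> words (carrier P)"
    using us vs by (auto simp: words_def pg.reduced_iff)
  have "\<phi> (word_class ?u) = \<phi> (word_class ?v)"
    using eq val_word reduced_closed us vs by simp
  then have "word_class ?u = word_class ?v"
    using iso word_class_closed w by (auto simp: iso_def bij_betw_def inj_on_def)
  then show "(?u, ?v) \<in> word_cong (carrier P) (pregroup_relations P)"
    using eq_equiv_class[OF _ equiv_word_cong w(2)] by metis
qed

text \<open>Sliding changes each factor only within its double coset with respect to \<open>pregroup_base P\<close>, which bounds
the change of its length however many slides are made.\<close>

definition same_double_coset :: "'p \<Rightarrow> 'p \<Rightarrow> bool" where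
  "same_double_coset u v \<longleftrightarrow> u \<in> carrier P \<and> v \<in> carrier P \<and>
    (\<exists>b \<in> pregroup_base P. \<exists>c \<in> pregroup_base P. \<iota> v = \<iota> b \<otimes> \<iota> u \<otimes> \<iota> c)"

lemma same_double_coset_refl: "u \<in> carrier P \<Longrightarrow> same_double_coset u u"
  unfolding same_double_coset_def using pg.base_one \<iota>_one by force

lemma same_double_coset_trans:
  assumes "same_double_coset u v" "same_double_coset v w" shows "same_double_coset u w"
proof -
  obtain b c b' c' where b: "b \<in> pregroup_base P" "c \<in> pregroup_base P"
    "b' \<in> pregroup_base P" "c' \<in> pregroup_base P"
    "\<iota> v = \<iota> b \<otimes> \<iota> u \<otimes> \<iota> c" "\<iota> w = \<iota> b' \<otimes> \<iota> v \<otimes> \<iota> c'" and u: "u \<in> carrier P" "w \<in> carrier P"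
    using assms unfolding same_double_coset_def by auto
  have "\<iota> w = \<iota> (b' \<otimes>\<^bsub>P\<^esub> b) \<otimes> \<iota> u \<otimes> \<iota> (c \<otimes>\<^bsub>P\<^esub> c')"
    using b u by (simp add: \<iota>_mult pg.base_defd pg.base_closed m_assoc)
  then show ?thesis using pg.base_mult b u unfolding same_double_coset_def by blast
qed

lemma slide_same_double_cosets:
  assumes "pg.slide us vs" "set us \<subseteq> carrier P"
  shows "list_all2 same_double_coset us vs"
  using assms
proof (induction rule: pg.slide.induct)
  case (1 b u v xs ys)
  have c: "pinv P b \<in> pregroup_base P" using pg.base_inv 1 by blast
  have "same_double_coset u (u \<otimes>\<^bsub>P\<^esub> b)"
    unfolding same_double_coset_def
    using 1 pg.base_one \<iota>_one \<iota>_mult pg.base_defd(1)[OF 1(1,2)] pg.mult_closed pg.base_closed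
    by (intro conjI bexI[of _ "\<one>\<^bsub>P\<^esub>"] bexI[of _ b]) auto
  moreover have "same_double_coset v (pinv P b \<otimes>\<^bsub>P\<^esub> v)"
    unfolding same_double_coset_def
    using 1 c pg.base_one \<iota>_one \<iota>_mult pg.base_defd(2)[OF c 1(3)] pg.mult_closed pg.base_closed
    by (intro conjI bexI[of _ "\<one>\<^bsub>P\<^esub>"] bexI[of _ "pinv P b"]) auto
  moreover have "list_all2 same_double_coset xs xs" "list_all2 same_double_coset ys ys"
    using 1 same_double_coset_refl by (auto intro!: list_all2_refl list.rel_refl_strong)
  ultimately show ?case by (simp add: list_all2_appendI)
qed

lemma slides_same_double_cosets:
  assumes "pg.slide\<^sup>*\<^sup>* us vs" "reduced_product P us"
  shows "list_all2 same_double_coset us vs"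
  using assms(1)
proof (induction rule: rtranclp_induct)
  case base
  then show ?case using reduced_closed[OF assms(2)] same_double_coset_refl
    by (auto intro!: list.rel_refl_strong)
next
  case (step vs ws)
  have "set vs \<subseteq> carrier P" using pg.slides_reduced[OF step(1) assms(2)] by (rule reduced_closed)
  from list_all2_trans[OF same_double_coset_trans step.IH slide_same_double_cosets[OF step(2) this]]
  show ?case .
qed

subsection \<open>Paths spelled by reduced products\<close>

text \<open>All geodesics along the partial products of \<open>us\<close>, starting at \<open>x\<close>.\<close>

fun track :: "'a \<Rightarrow> 'p list \<Rightarrow> 'a set" where
  "track x [] = {x}"
| "track x (u # us) = between x (x \<otimes> \<iota> u) \<union> track (x \<otimes> \<iota> u) us"

lemma track_start: "x \<in> carrier G \<Longrightarrow> set us \<subseteq> carrier P \<Longrightarrow> x \<in> track x us"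
  by (cases us) (auto simp: endpoints_between)

lemma track_closed: "x \<in> carrier G \<Longrightarrow> set us \<subseteq> carrier P \<Longrightarrow> track x us \<subseteq> carrier G"
  by (induction us arbitrary: x) (auto dest: subsetD[OF between_closed])

lemma track_append:
  "x \<in> carrier G \<Longrightarrow> set us \<subseteq> carrier P \<Longrightarrow> set vs \<subseteq> carrier P \<Longrightarrow>
    track x (us @ vs) = track x us \<union> track (x \<otimes> val us) vs"
proof (induction us arbitrary: x)
  case Nil
  then show ?case using track_start[of x vs] by auto
next
  case (Cons u us)
  then show ?case using Cons.IH[of "x \<otimes> \<iota> u"] by (auto simp: m_assoc)
qed

definition total_length :: "'p list \<Rightarrow> real" where
  "total_length us = (\<Sum>u\<leftarrow>us. real (word_length G S (\<iota> u)))"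

lemma track_bounded:
  "x \<in> carrier G \<Longrightarrow> set us \<subseteq> carrier P \<Longrightarrow> z \<in> track x us \<Longrightarrow> word_dist G S x z \<le> total_length us"
proof (induction us arbitrary: x)
  case Nil
  then show ?case by (simp add: total_length_def word_dist_self)
next
  case (Cons u us)
  let ?y = "x \<otimes> \<iota> u"
  have y: "?y \<in> carrier G" "\<iota> u \<in> carrier G" using Cons.prems by auto
  have len: "word_dist G S x ?y = real (word_length G S (\<iota> u))"
    using Cons.prems y by (simp add: word_dist_def flip: m_assoc)
  have nonneg: "0 \<le> total_length us" by (auto simp: total_length_def intro!: sum_list_nonneg)
  have z: "z \<in> carrier G" using track_closed[OF Cons.prems(1,2)] Cons.prems(3) by blast
  show ?case
  proof (cases "z \<in> between x ?y")
    case True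
    then have "word_dist G S x z \<le> word_dist G S x ?y"
      using word_dist_nonneg[of z ?y] by (simp add: between_def)
    then show ?thesis using len nonneg by (simp add: total_length_def)
  next
    case False
    then have "word_dist G S ?y z \<le> total_length us" using Cons y by simp
    then show ?thesis using word_dist_triangle[OF Cons.prems(1) y(1) z] len by (simp add: total_length_def)
  qed
qed

lemma track_chain:
  assumes "x \<in> carrier G" "set us \<subseteq> carrier P"
  shows "(x, x \<otimes> val us) \<in> {(u, v). u \<in> track x us \<and> v \<in> track x us \<and> word_dist G S u v \<le> 1}\<^sup>*"
  using assms
proof (induction us arbitrary: x)
  case (Cons u us)
  let ?y = "x \<otimes> \<iota> u" and ?R = "\<lambda>x us. {(u, v). u \<in> track x us \<and> v \<in> track x us \<and> word_dist G S u v \<le> 1}"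
  have y: "?y \<in> carrier G" "\<iota> u \<in> carrier G" "val us \<in> carrier G" using Cons.prems by auto
  have "(x, ?y) \<in> (?R x (u # us))\<^sup>*"
    by (rule subsetD[OF rtrancl_mono between_chain[OF Cons.prems(1) y(1)]]) auto
  moreover have "(?y, ?y \<otimes> val us) \<in> (?R x (u # us))\<^sup>*"
    by (rule subsetD[OF rtrancl_mono Cons.IH[OF y(1)]]) (use Cons.prems in auto)
  moreover have "x \<otimes> val (u # us) = ?y \<otimes> val us" using Cons.prems y by (simp add: m_assoc)
  ultimately show ?case by simp
qed simp

text \<open>All reduced products of an element are admitted, so that any product that cancellation delivers for the
third side of a triangle will do.\<close>

definition tracks :: "'a \<Rightarrow> 'a \<Rightarrow> 'a set" where
  "tracks x y = \<Union> {track x us | us. us \<noteq> [] \<and> reduced_product P us \<and> x \<otimes> val us = y}"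

lemma tracksI:
  "us \<noteq> [] \<Longrightarrow> reduced_product P us \<Longrightarrow> x \<otimes> val us = y \<Longrightarrow> z \<in> track x us \<Longrightarrow> z \<in> tracks x y"
  unfolding tracks_def by blast

lemma tracks_closed: "x \<in> carrier G \<Longrightarrow> tracks x y \<subseteq> carrier G"
  unfolding tracks_def using track_closed reduced_closed by blast

lemma reduced_between_exists:
  assumes "x \<in> carrier G" "y \<in> carrier G"
  obtains us where "us \<noteq> []" "reduced_product P us" "x \<otimes> val us = y"
proof -
  obtain us where us: "us \<noteq> []" "reduced_product P us" "val us = inv x \<otimes> y"
    using reduced_exists[of "inv x \<otimes> y"] assms by auto
  then show ?thesis using that assms by (simp flip: m_assoc)
qed

lemma tracks_chain:
  assumes x: "x \<in> carrier G" and y: "y \<in> carrier G"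
  shows "x \<in> tracks x y" "y \<in> tracks x y"
    "(x, y) \<in> {(u, v). u \<in> tracks x y \<and> v \<in> tracks x y \<and> word_dist G S u v \<le> 1}\<^sup>*"
proof -
  obtain us where us: "us \<noteq> []" "reduced_product P us" "x \<otimes> val us = y"
    using reduced_between_exists[OF x y] .
  have sub: "track x us \<subseteq> tracks x y" using us by (auto simp: tracks_def)
  have c: "set us \<subseteq> carrier P" by (rule reduced_closed[OF us(2)])
  show "x \<in> tracks x y" using sub track_start[OF x c] by blast
  have "track x us = track x us \<union> {y}" using track_append[OF x c, of "[]"] us by simp
  then have "y \<in> track x us" by blast
  then show "y \<in> tracks x y" using sub by blast
  show "(x, y) \<in> {(u, v). u \<in> tracks x y \<and> v \<in> tracks x y \<and> word_dist G S u v \<le> 1}\<^sup>*"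
    by (rule subsetD[OF rtrancl_mono track_chain[OF x c, unfolded us(3)]]) (use sub in auto)
qed

end

text \<open>The part of (H1) that enters the argument, for vertices; \<open>\<beta>\<close> bounds the lengths of the elements of
\<open>pregroup_base P\<close>.\<close>

locale group_of_thin_pregroup = group_of_pregroup P G S \<phi> \<iota>
  for P :: "'p pregroup" and G :: "('a, 'b) monoid_scheme" (structure) and S :: "'a set" and \<phi> \<iota> +
  fixes \<delta> \<beta> :: real
  assumes finite_generators: "finite S"
    and base_bounded: "\<And>b. b \<in> pregroup_base P \<Longrightarrow> real (word_length G S (\<iota> b)) \<le> \<beta>"
    and thin: "\<And>p q z. p \<in> carrier P \<Longrightarrow> q \<in> carrier P \<Longrightarrow> z \<in> between \<one> (\<iota> p) \<Longrightarrow>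
      \<exists>w \<in> between \<one> (\<iota> p \<otimes> \<iota> q) \<union> between (\<iota> p) (\<iota> p \<otimes> \<iota> q). word_dist G S z w \<le> \<delta>"
begin

lemma \<beta>_nonneg: "0 \<le> \<beta>"
  using base_bounded[OF pg.base_one] by linarith

lemma \<delta>_nonneg: "0 \<le> \<delta>"
proof -
  have "\<one> \<in> between \<one> (\<iota> \<one>\<^bsub>P\<^esub>)" using endpoints_between \<iota>_one by simp
  then obtain w where "word_dist G S \<one> w \<le> \<delta>" using thin pg.one_closed by blast
  then show ?thesis using word_dist_nonneg[of \<one> w] by linarith
qed

lemma translated_thin:
  assumes g: "g \<in> carrier G" and p: "p \<in> carrier P" and q: "q \<in> carrier P" and z: "z \<in> between g (g \<otimes> \<iota> p)"
  shows "\<exists>w \<in> between g (g \<otimes> \<iota> p \<otimes> \<iota> q) \<union> between (g \<otimes> \<iota> p) (g \<otimes> \<iota> p \<otimes> \<iota> q). word_dist G S z w \<le> \<delta>"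
proof -
  have zc: "z \<in> carrier G" using z between_closed by blast
  have "inv g \<otimes> z \<in> between \<one> (\<iota> p)"
    using between_translate[of "inv g" g "g \<otimes> \<iota> p" z] g p z by (simp flip: m_assoc)
  then obtain w where w: "w \<in> between \<one> (\<iota> p \<otimes> \<iota> q) \<union> between (\<iota> p) (\<iota> p \<otimes> \<iota> q)"
    "word_dist G S (inv g \<otimes> z) w \<le> \<delta>" using thin[OF p q] by blast
  have wc: "w \<in> carrier G" using w between_closed by blast
  have "word_dist G S z (g \<otimes> w) = word_dist G S (inv g \<otimes> z) w"
    using word_dist_translate[of g "inv g \<otimes> z" w] g zc wc by (simp flip: m_assoc)
  moreover have "g \<otimes> w \<in> between g (g \<otimes> \<iota> p \<otimes> \<iota> q) \<union> between (g \<otimes> \<iota> p) (g \<otimes> \<iota> p \<otimes> \<iota> q)"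
    using w between_translate[OF g, of \<one> "\<iota> p \<otimes> \<iota> q" w]
      between_translate[OF g, of "\<iota> p" "\<iota> p \<otimes> \<iota> q" w] g p q by (auto simp: m_assoc)
  ultimately show ?thesis using w by (intro bexI[of _ "g \<otimes> w"]) auto
qed

lemma base_edge:
  assumes g: "g \<in> carrier G" and b: "b \<in> pregroup_base P"
  shows "word_dist G S g (g \<otimes> \<iota> b) \<le> \<beta>"
  using base_bounded[OF b] g pg.base_closed[OF b] by (simp add: word_dist_def flip: m_assoc)

lemma base_edge_between:
  assumes "g \<in> carrier G" "b \<in> pregroup_base P" "w \<in> between g (g \<otimes> \<iota> b)"
  shows "word_dist G S w (g \<otimes> \<iota> b) \<le> \<beta>"
  using base_edge[OF assms(1,2)] assms(3) word_dist_nonneg[of g w] by (simp add: between_def)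

text \<open>The side \<open>g u, g u b\<close> of the triangle \<open>g, g u, g u b\<close> is short, so its other two sides are close to
each other.\<close>

lemma near_base_translate:
  assumes g: "g \<in> carrier G" and u: "u \<in> carrier P" and b: "b \<in> pregroup_base P"
    and z: "z \<in> between g (g \<otimes> \<iota> u)"
  shows "\<exists>w \<in> between g (g \<otimes> \<iota> u \<otimes> \<iota> b). word_dist G S z w \<le> \<delta> + \<beta>"
proof -
  let ?y = "g \<otimes> \<iota> u" and ?y' = "g \<otimes> \<iota> u \<otimes> \<iota> b"
  have c: "?y \<in> carrier G" "?y' \<in> carrier G" "\<iota> b \<in> carrier G" "z \<in> carrier G"
    using g u b pg.base_closed z between_closed by auto
  obtain w where w: "w \<in> between g ?y' \<union> between ?y ?y'" "word_dist G S z w \<le> \<delta>"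
    using translated_thin[OF g u pg.base_closed[OF b] z] by blast
  have wc: "w \<in> carrier G" using w between_closed by blast
  show ?thesis
  proof (cases "w \<in> between g ?y'")
    case True
    then show ?thesis using w base_edge[OF c(1) b] word_dist_nonneg[of ?y ?y']
      by (intro bexI[of _ w]) auto
  next
    case False
    then have "word_dist G S w ?y' \<le> \<beta>" using w base_edge_between[OF c(1) b] by blast
    then show ?thesis using w word_dist_triangle[OF c(4) wc c(2)] endpoints_between[OF g c(2)]
      by (intro bexI[of _ ?y']) auto
  qed
qed

lemma near_merged:
  assumes g: "g \<in> carrier G" and u: "u \<in> carrier P" and b: "b \<in> pregroup_base P" and v: "v \<in> carrier P"
    and z: "z \<in> between g (g \<otimes> \<iota> u)"
  shows "\<exists>w \<in> between g (g \<otimes> \<iota> u \<otimes> \<iota> b \<otimes> \<iota> v) \<union>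
      between (g \<otimes> \<iota> u \<otimes> \<iota> b) (g \<otimes> \<iota> u \<otimes> \<iota> b \<otimes> \<iota> v).
    word_dist G S z w \<le> 2 * \<delta> + \<beta>"
proof -
  let ?y = "g \<otimes> \<iota> u \<otimes> \<iota> b" and ?t = "g \<otimes> \<iota> u \<otimes> \<iota> b \<otimes> \<iota> v"
  note ub = pg.base_defd(1)[OF b u]
  have y: "?y = g \<otimes> \<iota> (u \<otimes>\<^bsub>P\<^esub> b)" using g u b by (simp add: \<iota>_mult[OF ub] m_assoc pg.base_closed)
  obtain w where w: "w \<in> between g ?y" "word_dist G S z w \<le> \<delta> + \<beta>"
    using near_base_translate[OF g u b z] by blast
  obtain w' where w': "w' \<in> between g ?t \<union> between ?y ?t" "word_dist G S w w' \<le> \<delta>"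
    using translated_thin[OF g pg.mult_closed[OF ub] v] w(1) unfolding y by blast
  have "z \<in> carrier G" "w \<in> carrier G" "w' \<in> carrier G" using z w w' between_closed by blast+
  then show ?thesis using word_dist_triangle[of z w w'] w w' by (intro bexI[of _ w']) auto
qed

text \<open>The cancellation of \<open>us\<close> against \<open>vs\<close>, by induction on \<open>us\<close> from the right. The element \<open>b\<close> carried along
is kept apart from the factors: if it were multiplied into the last factor of \<open>us\<close>, the track would
move by a bounded amount at every step, and these amounts would add up. This way every factor of \<open>us\<close>
is compared with its final partner directly, at a cost of at most \<open>2 * (\<delta> + \<beta>)\<close>.\<close>

lemma track_near_product:
  assumes "x \<in> carrier G" "reduced_product P us" "reduced_product P vs" "b \<in> pregroup_base P"
  shows "\<exists>ws. ws \<noteq> [] \<and> reduced_product P ws \<and> val ws = val us \<otimes> \<iota> b \<otimes> val vs \<and>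
    (\<forall>z \<in> track x us. \<exists>w \<in> track x ws \<union> track (x \<otimes> val us \<otimes> \<iota> b) vs.
      word_dist G S z w \<le> 2 * (\<delta> + \<beta>))"
  using assms(2-4)
proof (induction us arbitrary: b vs rule: rev_induct)
  case Nil
  have x: "x \<in> carrier G" by fact
  have bc: "b \<in> carrier P" using Nil pg.base_closed by blast
  have vc: "set vs \<subseteq> carrier P" using Nil reduced_closed by blast
  define ws where "ws = (case vs of [] \<Rightarrow> [b] | v # vs' \<Rightarrow> (b \<otimes>\<^bsub>P\<^esub> v) # vs')"
  have "ws \<noteq> [] \<and> reduced_product P ws \<and> val ws = \<iota> b \<otimes> val vs"
  proof (cases vs)
    case Nil
    then show ?thesis using bc by (simp add: ws_def pg.reduced_iff)
  next
    case (Cons v vs')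
    then show ?thesis using Nil.prems vc bc pg.base_left(1) pg.base_defd
      by (auto simp: ws_def pg.reduced_iff successively_Cons \<iota>_mult m_assoc pg.mult_closed)
  qed
  moreover have "x \<in> track x ws" using track_start x reduced_closed calculation by blast
  moreover have "word_dist G S x x \<le> 2 * (\<delta> + \<beta>)"
    using x word_dist_self \<delta>_nonneg \<beta>_nonneg by simp
  ultimately have "\<exists>w \<in> track x ws \<union> track (x \<otimes> val [] \<otimes> \<iota> b) vs. word_dist G S x w \<le> 2 * (\<delta> + \<beta>)"
    by blast
  then show ?case using x bc vc \<open>ws \<noteq> [] \<and> _\<close> by (intro exI[of _ ws]) simp
next
  case (snoc u us)
  have x: "x \<in> carrier G" by fact
  let ?m = "x \<otimes> val us" and ?K = "2 * (\<delta> + \<beta>)"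
  let ?y = "?m \<otimes> \<iota> u" and ?y' = "?m \<otimes> \<iota> u \<otimes> \<iota> b"
  have b: "b \<in> pregroup_base P" "b \<in> carrier P" using snoc.prems pg.base_closed by auto
  have us: "reduced_product P us" "set us \<subseteq> carrier P" "u \<in> carrier P"
    and last: "us \<noteq> [] \<Longrightarrow> (last us, u) \<notin> defd P"
    using snoc.prems(1) by (auto simp: pg.reduced_iff successively_append_iff)
  have vs: "set vs \<subseteq> carrier P" using snoc.prems(2) reduced_closed by blast
  note ub = pg.base_defd(1)[OF b(1) us(3)]
  have ubc: "u \<otimes>\<^bsub>P\<^esub> b \<in> carrier P" by (rule pg.mult_closed[OF ub])
  have c: "?m \<in> carrier G" "\<iota> u \<in> carrier G" "\<iota> b \<in> carrier G" "val us \<in> carrier G"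
    "val vs \<in> carrier G" using x us b vs by auto
  have y': "?m \<otimes> \<iota> (u \<otimes>\<^bsub>P\<^esub> b) = ?y'" using c us b by (simp add: \<iota>_mult[OF ub] m_assoc)
  have start: "x \<otimes> val (us @ [u]) \<otimes> \<iota> b = ?y'" using x c us by (simp add: val_append m_assoc)
  have track: "track x (us @ [u]) = track x us \<union> between ?m ?y"
    using track_append[OF x us(2), of "[u]"] us endpoints_between[of ?m ?y] c by auto
  have self: "\<exists>w \<in> A. word_dist G S z w \<le> ?K" if "z \<in> track x us" "track x us \<subseteq> A" for z A
    using that word_dist_self track_closed[OF x us(2)] \<delta>_nonneg \<beta>_nonneg
    by (intro bexI[of _ z]) auto
  have last': "us \<noteq> [] \<Longrightarrow> (last us, u \<otimes>\<^bsub>P\<^esub> b) \<notin> defd P"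
    using last pg.base_right(1)[OF b(1) us(3)] by blast
  show ?case
  proof (cases "vs = [] \<or> (u \<otimes>\<^bsub>P\<^esub> b, hd vs) \<notin> defd P")
    case True
    \<comment> \<open>No cancellation: the concatenation, with \<open>b\<close> absorbed by \<open>u\<close>, is reduced.\<close>
    let ?ws = "us @ (u \<otimes>\<^bsub>P\<^esub> b) # vs"
    have "reduced_product P ?ws"
      using us vs ubc last' True snoc.prems(2)
      by (cases vs) (auto simp: pg.reduced_iff successively_append_iff successively_Cons)
    moreover have "val ?ws = val (us @ [u]) \<otimes> \<iota> b \<otimes> val vs"
      using us vs ubc c by (simp add: val_append \<iota>_mult[OF ub] m_assoc)
    moreover have "track x us \<union> between ?m ?y' \<subseteq> track x ?ws"
      using track_append[OF x us(2), of "(u \<otimes>\<^bsub>P\<^esub> b) # vs"] ubc vs y' by auto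
    moreover have "\<exists>w \<in> track x ?ws. word_dist G S z w \<le> ?K" if z: "z \<in> between ?m ?y" for z
    proof -
      obtain w where "w \<in> between ?m ?y'" "word_dist G S z w \<le> \<delta> + \<beta>"
        using near_base_translate[OF c(1) us(3) b(1) z] by blast
      then show ?thesis using calculation(3) \<delta>_nonneg \<beta>_nonneg by (intro bexI[of _ w]) auto
    qed
    moreover have "\<forall>z \<in> track x us \<union> between ?m ?y. \<exists>w \<in> track x ?ws. word_dist G S z w \<le> ?K"
      using self[of _ "track x ?ws"] calculation(3,4) by blast
    ultimately show ?thesis unfolding track start by (intro exI[of _ ?ws]) blast
  next
    case False
    then obtain v vs' where v: "vs = v # vs'" "(u \<otimes>\<^bsub>P\<^esub> b, v) \<in> defd P" by (cases vs) auto
    let ?w = "u \<otimes>\<^bsub>P\<^esub> b \<otimes>\<^bsub>P\<^esub> v"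
    have wc: "?w \<in> carrier P" by (rule pg.mult_closed[OF v(2)])
    have vc: "v \<in> carrier P" "set vs' \<subseteq> carrier P" "\<iota> v \<in> carrier G" "val vs' \<in> carrier G"
      using vs v by auto
    have \<iota>w: "\<iota> ?w = \<iota> u \<otimes> \<iota> b \<otimes> \<iota> v" by (simp add: \<iota>_mult[OF v(2)] \<iota>_mult[OF ub])
    have t: "?m \<otimes> \<iota> ?w = ?y' \<otimes> \<iota> v" using c vc by (simp add: \<iota>w m_assoc)
    have vs': "reduced_product P vs'" and next_v: "vs' \<noteq> [] \<Longrightarrow> (v, hd vs') \<notin> defd P"
      using snoc.prems(2) v by (auto simp: pg.reduced_iff successively_Cons)
    have target: "track ?y' vs = between ?y' (?y' \<otimes> \<iota> v) \<union> track (?y' \<otimes> \<iota> v) vs'" by (simp add: v)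
    have merged: "\<exists>w \<in> between ?m (?y' \<otimes> \<iota> v) \<union> between ?y' (?y' \<otimes> \<iota> v).
        word_dist G S z w \<le> 2 * \<delta> + \<beta>" if "z \<in> between ?m ?y" for z
      by (rule near_merged[OF c(1) us(3) b(1) vc(1) that])
    show ?thesis
    proof (cases "?w \<in> pregroup_base P")
      \<comment> \<open>The factors \<open>u b\<close> and \<open>v\<close> merge; this is the central triangle of the tripod.\<close>
      case nb: False
      let ?ws = "us @ ?w # vs'"
      have left: "us \<noteq> [] \<Longrightarrow> (last us, ?w) \<notin> defd P"
        using pg.merge_right[OF last' _ v(2) nb] us(2) last_in_set by blast
      have right: "vs' \<noteq> [] \<Longrightarrow> (?w, hd vs') \<notin> defd P"
        using pg.merge_left[OF next_v _ v(2) nb] vc(2) hd_in_set by blast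
      have "reduced_product P ?ws"
        using us vs' wc left right
        by (cases vs') (auto simp: pg.reduced_iff successively_append_iff successively_Cons)
      moreover have "val ?ws = val (us @ [u]) \<otimes> \<iota> b \<otimes> val vs"
        using us vc wc c by (simp add: v val_append \<iota>w m_assoc)
      moreover have "track x us \<union> between ?m (?y' \<otimes> \<iota> v) \<subseteq> track x ?ws"
        using track_append[OF x us(2), of "?w # vs'"] wc vc t by auto
      moreover have "\<exists>w \<in> track x ?ws \<union> track ?y' vs. word_dist G S z w \<le> ?K"
        if z: "z \<in> between ?m ?y" for z
      proof -
        obtain w where "w \<in> between ?m (?y' \<otimes> \<iota> v) \<union> between ?y' (?y' \<otimes> \<iota> v)"
          "word_dist G S z w \<le> 2 * \<delta> + \<beta>" using merged[OF z] by blast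
        then show ?thesis using calculation(3) target \<delta>_nonneg \<beta>_nonneg
          by (intro bexI[of _ w]) auto
      qed
      moreover have "\<forall>z \<in> track x us \<union> between ?m ?y. \<exists>w \<in> track x ?ws \<union> track ?y' vs.
          word_dist G S z w \<le> ?K"
        using self[of _ "track x ?ws \<union> track ?y' vs"] calculation(3,4) by blast
      ultimately show ?thesis unfolding track start by (intro exI[of _ ?ws]) blast
    next
      \<comment> \<open>The factors cancel, and \<open>u b v\<close> is carried on to the remaining factors.\<close>
      case wB: True
      obtain ws where ws: "ws \<noteq> []" "reduced_product P ws" "val ws = val us \<otimes> \<iota> ?w \<otimes> val vs'"
        "\<forall>z \<in> track x us. \<exists>w \<in> track x ws \<union> track (?m \<otimes> \<iota> ?w) vs'. word_dist G S z w \<le> ?K"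
        using snoc.IH[OF us(1) vs' wB] by blast
      have val: "val ws = val (us @ [u]) \<otimes> \<iota> b \<otimes> val vs"
        using ws(3) us vc c by (simp add: v val_append \<iota>w m_assoc)
      have tc: "?y' \<otimes> \<iota> v \<in> carrier G" "?y' \<in> carrier G" using c vc by auto
      have "\<exists>w \<in> track ?y' vs. word_dist G S z w \<le> ?K" if z: "z \<in> between ?m ?y" for z
      proof -
        obtain w where w: "w \<in> between ?m (?y' \<otimes> \<iota> v) \<union> between ?y' (?y' \<otimes> \<iota> v)"
          "word_dist G S z w \<le> 2 * \<delta> + \<beta>" using merged[OF z] by blast
        show ?thesis
        proof (cases "w \<in> between ?y' (?y' \<otimes> \<iota> v)")
          case True
          then show ?thesis using w target \<beta>_nonneg by (intro bexI[of _ w]) auto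
        next
          case False
          then have "w \<in> between ?m (?m \<otimes> \<iota> ?w)" using w t by simp
          from base_edge_between[OF c(1) wB this] have "word_dist G S w (?y' \<otimes> \<iota> v) \<le> \<beta>"
            using t by simp
          moreover have "z \<in> carrier G" "w \<in> carrier G" using z w between_closed by blast+
          ultimately have "word_dist G S z (?y' \<otimes> \<iota> v) \<le> ?K"
            using word_dist_triangle[of z w "?y' \<otimes> \<iota> v"] w(2) tc by simp
          moreover have "?y' \<otimes> \<iota> v \<in> track ?y' vs" using target endpoints_between tc by blast
          ultimately show ?thesis by blast
        qed
      qed
      moreover have "track (?m \<otimes> \<iota> ?w) vs' \<subseteq> track ?y' vs" using target t by auto
      ultimately have "\<forall>z \<in> track x (us @ [u]). \<exists>w \<in> track x ws \<union> track ?y' vs. word_dist G S z w \<le> ?K"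
        unfolding track using ws(4) by blast
      then show ?thesis unfolding start using ws val by blast
    qed
  qed
qed

lemma tracks_thin:
  assumes x: "x \<in> carrier G" and y: "y \<in> carrier G" and z: "z \<in> carrier G" and a: "a \<in> tracks x y"
  shows "\<exists>b \<in> tracks x z \<union> tracks y z. word_dist G S a b \<le> 2 * (\<delta> + \<beta>)"
proof -
  obtain us where us: "us \<noteq> []" "reduced_product P us" "x \<otimes> val us = y" "a \<in> track x us"
    using a by (auto simp: tracks_def)
  obtain vs where vs: "vs \<noteq> []" "reduced_product P vs" "y \<otimes> val vs = z"
    using reduced_between_exists[OF y z] .
  have c: "val us \<in> carrier G" "val vs \<in> carrier G" using us vs reduced_closed by auto
  obtain ws b where ws: "ws \<noteq> []" "reduced_product P ws" "val ws = val us \<otimes> val vs"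
    and b: "b \<in> track x ws \<union> track y vs" "word_dist G S a b \<le> 2 * (\<delta> + \<beta>)"
  proof -
    obtain ws where ws: "ws \<noteq> []" "reduced_product P ws" "val ws = val us \<otimes> val vs"
      "\<forall>z \<in> track x us. \<exists>w \<in> track x ws \<union> track y vs. word_dist G S z w \<le> 2 * (\<delta> + \<beta>)"
      using track_near_product[OF x us(2) vs(2) pg.base_one] us(3) c y by (auto simp: \<iota>_one)
    then show ?thesis using that us(4) by blast
  qed
  have "x \<otimes> val ws = z" using ws(3) us(3) vs(3) x c by (simp flip: m_assoc)
  then have "b \<in> tracks x z \<union> tracks y z"
    using b(1) tracksI[OF ws(1,2)] tracksI[OF vs] by blast
  then show ?thesis using b by blast
qed

lemma finite_ball: "finite {g \<in> carrier G. word_length G S g \<le> n}"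
proof -
  have "finite ((\<lambda>ws. foldr (mult G) ws \<one>) ` {ws. set ws \<subseteq> letters \<and> length ws \<le> n})"
    using finite_generators by (intro finite_imageI finite_lists_length_le) (simp add: letters_def)
  moreover have "{g \<in> carrier G. word_length G S g \<le> n} \<subseteq>
      (\<lambda>ws. foldr (mult G) ws \<one>) ` {ws. set ws \<subseteq> letters \<and> length ws \<le> n}"
  proof
    fix g assume g: "g \<in> {g \<in> carrier G. word_length G S g \<le> n}"
    then obtain ws where "spells ws g" "length ws = word_length G S g"
      using word_length_attained by blast
    then show "g \<in> (\<lambda>ws. foldr (mult G) ws \<one>) ` {ws. set ws \<subseteq> letters \<and> length ws \<le> n}"
      using g by (auto simp: spells_def)
  qed
  ultimately show ?thesis by (rule rev_finite_subset)
qed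

lemma double_coset_length:
  assumes "same_double_coset u v"
  shows "real (word_length G S (\<iota> v)) \<le> real (word_length G S (\<iota> u)) + 2 * \<beta>"
proof -
  obtain b c where bc: "b \<in> pregroup_base P" "c \<in> pregroup_base P" "\<iota> v = \<iota> b \<otimes> \<iota> u \<otimes> \<iota> c"
    and u: "\<iota> u \<in> carrier G" using assms by (auto simp: same_double_coset_def)
  have c: "\<iota> b \<in> carrier G" "\<iota> c \<in> carrier G" using bc pg.base_closed by auto
  have "word_length G S (\<iota> v) \<le> word_length G S (\<iota> b) + word_length G S (\<iota> u) + word_length G S (\<iota> c)"
    unfolding bc(3) using word_length_mult[of "\<iota> b \<otimes> \<iota> u" "\<iota> c"] word_length_mult[of "\<iota> b" "\<iota> u"] c u
    by simp
  then show ?thesis using base_bounded[OF bc(1)] base_bounded[OF bc(2)] by linarith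
qed

lemma double_cosets_total_length:
  "list_all2 same_double_coset us vs \<Longrightarrow> total_length vs \<le> total_length us + 2 * \<beta> * real (length us)"
proof (induction rule: list_all2_induct)
  case (Cons u us v vs)
  then show ?case using double_coset_length[of u v] by (simp add: total_length_def algebra_simps)
qed (simp add: total_length_def)

text \<open>An element has only boundedly different reduced products, by uniqueness up to sliding, and a ball of \<open>G\<close>
is finite.\<close>

lemma tracks_bounded:
  "\<exists>H. \<forall>x \<in> carrier G. \<forall>y \<in> carrier G. \<forall>a \<in> tracks x y. word_dist G S x y \<le> real n \<longrightarrow> word_dist G S x a \<le> H"
proof -
  let ?F = "{g \<in> carrier G. word_length G S g \<le> n}"
  define Q where "Q g H \<longleftrightarrow> (\<forall>us. us \<noteq> [] \<and> reduced_product P us \<and> val us = g \<longrightarrow> total_length us \<le> H)"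
    for g H
  have "\<exists>H. Q g H" if g: "g \<in> carrier G" for g
  proof -
    obtain us where us: "us \<noteq> []" "reduced_product P us" "val us = g" using reduced_exists[OF g] by blast
    have "total_length vs \<le> total_length us + 2 * \<beta> * real (length us)"
      if "vs \<noteq> []" "reduced_product P vs" "val vs = g" for vs
      using double_cosets_total_length[OF slides_same_double_cosets[OF reduced_unique[OF us(1,2) that(1,2)] us(2)]]
        us that by simp
    then show ?thesis unfolding Q_def by blast
  qed
  then obtain f where f: "Q g (f g)" if "g \<in> carrier G" for g by metis
  have "word_dist G S x a \<le> Max (f ` ?F)"
    if x: "x \<in> carrier G" "y \<in> carrier G" "a \<in> tracks x y" "word_dist G S x y \<le> real n" for x y a
  proof -
    obtain us where us: "us \<noteq> []" "reduced_product P us" "x \<otimes> val us = y" "a \<in> track x us"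
      using x by (auto simp: tracks_def)
    have c: "val us \<in> carrier G" using us reduced_closed by simp
    have "inv x \<otimes> y = val us" unfolding us(3)[symmetric] using x c by (simp flip: m_assoc)
    then have F: "val us \<in> ?F" using x c by (simp add: word_dist_def)
    have "word_dist G S x a \<le> total_length us"
      using track_bounded[OF x(1) reduced_closed[OF us(2)] us(4)] .
    also have "\<dots> \<le> f (val us)" using f[OF c] us unfolding Q_def by blast
    also have "\<dots> \<le> Max (f ` ?F)" using F finite_ball[of n] by (intro Max_ge) auto
    finally show ?thesis .
  qed
  then show ?thesis by blast
qed

definition nearby_vertex :: "('a \<Rightarrow> real) \<Rightarrow> 'a" where
  "nearby_vertex x = (SOME g. g \<in> supp x)"

lemma nearby_vertex:
  assumes "x \<in> cayley_graph G S"
  shows "nearby_vertex x \<in> carrier G" "cayley_dist G S x (vertex (nearby_vertex x)) \<le> 1"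
proof -
  let ?g = "nearby_vertex x"
  have g: "?g \<in> supp x" unfolding nearby_vertex_def using point_supp(2)[OF assms] by (simp add: some_in_eq)
  then show c: "?g \<in> carrier G" using point_supp(3)[OF assms] by blast
  have "vertex ?g ?g = 1" by (simp add: vertex_def)
  then show "cayley_dist G S x (vertex ?g) \<le> 1"
    using dist_le[OF assms vertex_in_cayley_graph[OF c] g, of ?g] point_coord[OF assms g]
      word_dist_self[OF c] by simp
qed

theorem cayley_graph_thin: "\<exists>\<delta> > 0. cayley_thin G S \<delta>"
proof -
  let ?X = "cayley_graph G S" and ?d = "cayley_dist G S" and ?\<nu> = "nearby_vertex"
  let ?L = "\<lambda>x y. vertex ` tracks (?\<nu> x) (?\<nu> y)"
  obtain H where H: "\<And>x y a. x \<in> carrier G \<Longrightarrow> y \<in> carrier G \<Longrightarrow> a \<in> tracks x y \<Longrightarrow>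
      word_dist G S x y \<le> 3 \<Longrightarrow> word_dist G S x a \<le> H"
    \<comment> \<open>Points at distance at most \<open>1\<close> have nearby vertices at distance at most \<open>3\<close>.\<close>
    using tracks_bounded[of 3] by auto
  define h where "h = max (2 * (\<delta> + \<beta>)) (max (H + 1) 1)"
  have h: "2 * (\<delta> + \<beta>) \<le> h" "H + 1 \<le> h" "1 \<le> h" by (auto simp: h_def)
  have tri: "?d x z \<le> ?d x y + ?d y z" if "x \<in> ?X" "y \<in> ?X" "z \<in> ?X" for x y z
    by (rule cayley_dist_triangle[OF that])
  have \<nu>: "?\<nu> x \<in> carrier G" "vertex (?\<nu> x) \<in> ?X" "?d x (vertex (?\<nu> x)) \<le> 1" if "x \<in> ?X" for x
    using nearby_vertex[OF that] vertex_in_cayley_graph by auto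
  have dv: "?d (vertex a) (vertex b) = word_dist G S a b"
    if "a \<in> carrier G" "b \<in> carrier G" for a b using cayley_dist_vertex that by blast
  have tc: "a \<in> carrier G" if "a \<in> tracks (?\<nu> x) y" "x \<in> ?X" for a x y
    using tracks_closed[OF \<nu>(1)] that by blast
  interpret guessed_geodesics ?X ?d ?L h
  proof
    show "?d x y = ?d y x" if "x \<in> ?X" "y \<in> ?X" for x y by (rule cayley_dist_commute[OF that])
    show "?d x z \<le> ?d x y + ?d y z" if "x \<in> ?X" "y \<in> ?X" "z \<in> ?X" for x y z by (rule tri[OF that])
    show "?d x x = 0" if "x \<in> ?X" for x using cayley_dist_zero[OF that that] by simp
    show "0 < h" using h by linarith
    show "?L x y \<subseteq> ?X" if "x \<in> ?X" "y \<in> ?X" for x y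
      using tc[OF _ that(1)] vertex_in_cayley_graph by blast
    show "\<exists>b \<in> ?L x z \<union> ?L y z. ?d a b \<le> h"
      if m: "x \<in> ?X" "y \<in> ?X" "z \<in> ?X" and a: "a \<in> ?L x y" for x y z a
    proof -
      obtain a' where a': "a' \<in> tracks (?\<nu> x) (?\<nu> y)" "a = vertex a'" using a by blast
      obtain b where b: "b \<in> tracks (?\<nu> x) (?\<nu> z) \<union> tracks (?\<nu> y) (?\<nu> z)"
        "word_dist G S a' b \<le> 2 * (\<delta> + \<beta>)"
        using tracks_thin[OF \<nu>(1)[OF m(1)] \<nu>(1)[OF m(2)] \<nu>(1)[OF m(3)] a'(1)] by blast
      have "b \<in> carrier G" using b tc m by blast
      then have "?d a (vertex b) \<le> h" using a' b h dv tc[OF a'(1) m(1)] by simp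
      then show ?thesis using b by blast
    qed
    show "?d x a \<le> h" if m: "x \<in> ?X" "y \<in> ?X" and xy: "?d x y \<le> 1" and a: "a \<in> ?L x y" for x y a
    proof -
      obtain a' where a': "a' \<in> tracks (?\<nu> x) (?\<nu> y)" "a = vertex a'" using a by blast
      let ?vx = "vertex (?\<nu> x)" and ?vy = "vertex (?\<nu> y)"
      have "?d ?vx ?vy \<le> ?d x ?vx + ?d x y + ?d y ?vy"
        using tri[OF \<nu>(2)[OF m(1)] m(1) \<nu>(2)[OF m(2)]] tri[OF m \<nu>(2)[OF m(2)]]
          cayley_dist_commute[OF \<nu>(2)[OF m(1)] m(1)] by linarith
      then have "word_dist G S (?\<nu> x) (?\<nu> y) \<le> 3"
        using \<nu>(3)[OF m(1)] \<nu>(3)[OF m(2)] xy dv \<nu>(1) m by simp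
      then have "word_dist G S (?\<nu> x) a' \<le> H" using H[OF \<nu>(1) \<nu>(1) a'(1)] m by simp
      moreover have "a' \<in> carrier G" using tc[OF a'(1) m(1)] .
      ultimately show ?thesis
        using tri[OF m(1) \<nu>(2)[OF m(1)] vertex_in_cayley_graph[of a']] \<nu>(3)[OF m(1)]
          dv[OF \<nu>(1)[OF m(1)], of a'] h a'(2) by simp
    qed
    show "\<exists>a \<in> ?L x y. \<exists>b \<in> ?L x y. ?d x a \<le> h \<and> ?d y b \<le> h \<and>
        (a, b) \<in> {(u, v). u \<in> ?L x y \<and> v \<in> ?L x y \<and> ?d u v \<le> h}\<^sup>*"
      if m: "x \<in> ?X" "y \<in> ?X" for x y
    proof -
      let ?T = "tracks (?\<nu> x) (?\<nu> y)"
      let ?R = "{(u, v). u \<in> ?L x y \<and> v \<in> ?L x y \<and> ?d u v \<le> h}"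
      note T = tracks_chain[OF \<nu>(1)[OF m(1)] \<nu>(1)[OF m(2)]]
      have edge: "(vertex u, vertex v) \<in> ?R" if "u \<in> ?T" "v \<in> ?T" "word_dist G S u v \<le> 1" for u v
      proof -
        have "?d (vertex u) (vertex v) \<le> h"
          using that(3) h(3) dv[OF tc[OF that(1) m(1)] tc[OF that(2) m(1)]] by linarith
        then show ?thesis using imageI[OF that(1), of vertex] imageI[OF that(2), of vertex] by simp
      qed
      have "(vertex (?\<nu> x), vertex g) \<in> ?R\<^sup>*"
        if "(?\<nu> x, g) \<in> {(u, v). u \<in> ?T \<and> v \<in> ?T \<and> word_dist G S u v \<le> 1}\<^sup>*" for g
        using that
      proof (induction rule: rtrancl_induct)
        case (step u v)
        from step(2) have "u \<in> ?T" "v \<in> ?T" "word_dist G S u v \<le> 1" by simp_all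
        then have "(vertex u, vertex v) \<in> ?R" by (rule edge)
        with step.IH show ?case by (rule rtrancl_into_rtrancl)
      qed simp
      from this[OF T(3)] have "(vertex (?\<nu> x), vertex (?\<nu> y)) \<in> ?R\<^sup>*" .
      moreover have "?d x (vertex (?\<nu> x)) \<le> h" "?d y (vertex (?\<nu> y)) \<le> h"
        using \<nu>(3)[OF m(1)] \<nu>(3)[OF m(2)] h(3) by linarith+
      ultimately show ?thesis using imageI[OF T(1), of vertex] imageI[OF T(2), of vertex] by blast
    qed
  qed
  show ?thesis using triangles_thin unfolding cayley_thin_def .
qed

end

section \<open>Passing to an isomorphic group\<close>

text \<open>Transport of distances along isomorphisms, for the passage from \<open>G\<close> to \<open>universal_group P\<close>.\<close>

lemma word_length_hom_le:
  assumes G: "generated_group G S" and H: "generated_group H T"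
    and h: "h \<in> hom G H" "h ` S \<subseteq> T" and g: "g \<in> carrier G"
  shows "word_length H T (h g) \<le> word_length G S g"
proof -
  interpret G: generated_group G S by (rule G)
  interpret H: generated_group H T by (rule H)
  interpret h: group_hom G H h using h(1) by unfold_locales
  have letters: "h a \<in> H.letters" if a: "a \<in> G.letters" for a
  proof -
    consider "a \<in> S" | s where "s \<in> S" "a = inv\<^bsub>G\<^esub> s" using a by (auto simp: G.letters_def)
    then show ?thesis
    proof cases
      case 1
      then show ?thesis using h(2) by (auto simp: H.letters_def)
    next
      case 2
      then have "h a = inv\<^bsub>H\<^esub> (h s)" using G.S h.hom_inv by blast
      moreover have "h s \<in> T" using 2 h(2) by blast
      ultimately show ?thesis by (simp add: H.letters_def)
    qed
  qed
  obtain ws where ws: "G.spells ws g" "length ws = word_length G S g"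
    using G.word_length_attained[OF g] .
  have "foldr (mult H) (map h ws) \<one>\<^bsub>H\<^esub> = h (foldr (mult G) ws \<one>\<^bsub>G\<^esub>)" if "set ws \<subseteq> G.letters" for ws
    using that
  proof (induction ws)
    case (Cons a ws)
    then show ?case using G.letters_closed G.foldr_closed[of ws] by auto
  qed simp
  then have "H.spells (map h ws) (h g)" using ws letters by (auto simp: G.spells_def H.spells_def)
  from H.word_length_le[OF this] show ?thesis using ws by simp
qed

lemma iso_imp_word_length_eq:
  assumes "generated_group G S" "generated_group H T" "h \<in> iso G H" "h ` S = T" "g \<in> carrier G"
  shows "word_length H T (h g) = word_length G S g"
proof (rule antisym)
  interpret G: generated_group G S by (rule assms(1))
  let ?k = "inv_into (carrier G) h"
  have k: "?k \<in> hom H G" using G.iso_set_sym[OF assms(3)] by (simp add: iso_def)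
  have inj: "inj_on h (carrier G)" using assms(3) by (simp add: iso_def bij_betw_def)
  have "?k ` T \<subseteq> S" using assms(4) G.S inj by (auto simp: subset_iff)
  then have "word_length G S (?k (h g)) \<le> word_length H T (h g)"
    using word_length_hom_le[OF assms(2,1) k] assms(3,5) by (auto simp: iso_def hom_def)
  then show "word_length G S g \<le> word_length H T (h g)" using inj assms(5) by simp
  show "word_length H T (h g) \<le> word_length G S g"
    using word_length_hom_le[OF assms(1,2)] assms(3,4,5) by (auto simp: iso_def)
qed

lemma iso_imp_word_dist_eq:
  assumes "generated_group G S" "generated_group H T" "h \<in> iso G H" "h ` S = T"
    and "x \<in> carrier G" "y \<in> carrier G"
  shows "word_dist H T (h x) (h y) = word_dist G S x y"
proof -
  interpret G: generated_group G S by (rule assms(1))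
  interpret H: generated_group H T by (rule assms(2))
  interpret h: group_hom G H h using assms(3) by unfold_locales (simp add: iso_def)
  have eq: "inv\<^bsub>H\<^esub> (h x) \<otimes>\<^bsub>H\<^esub> h y = h (inv\<^bsub>G\<^esub> x \<otimes>\<^bsub>G\<^esub> y)" using assms(5,6) by simp
  have "inv\<^bsub>G\<^esub> x \<otimes>\<^bsub>G\<^esub> y \<in> carrier G" using assms(5,6) by simp
  from iso_imp_word_length_eq[OF assms(1-4) this] show ?thesis by (simp only: word_dist_def eq)
qed

lemma iso_between:
  assumes "generated_group G S" "generated_group H T" "h \<in> iso G H" "h ` S = T"
    and "x \<in> carrier G" "y \<in> carrier G" "z \<in> carrier G"
  shows "h z \<in> generated_group.between H T (h x) (h y) \<longleftrightarrow> z \<in> generated_group.between G S x y"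
proof -
  have "h z \<in> carrier H" using assms(3,7) by (auto simp: iso_def hom_def)
  then show ?thesis
    using assms iso_imp_word_dist_eq[OF assms(1-4)]
    by (simp add: generated_group.between_def)
qed

section \<open>Hyperbolicity of the universal group\<close>

lemma (in group_of_pregroup) group_of_thin_pregroupI:
  assumes fin: "finite S" "finite (pregroup_base P)"
    and thin: "\<And>p q z. p \<in> carrier P \<Longrightarrow> q \<in> carrier P \<Longrightarrow> z \<in> between \<one> (\<iota> p) \<Longrightarrow>
      \<exists>w \<in> between \<one> (\<iota> p \<otimes> \<iota> q) \<union> between (\<iota> p) (\<iota> p \<otimes> \<iota> q). word_dist G S z w \<le> \<delta>"
  shows "group_of_thin_pregroup P G S \<phi> \<iota> \<delta> (Max ((\<lambda>b. real (word_length G S (\<iota> b))) ` pregroup_base P))"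
  by unfold_locales (use assms in auto)

theorem theorem5:
  fixes G :: "('a, 'b) monoid_scheme" (structure)
    and S :: "'a set"
    and P :: "'p pregroup"
    and \<phi> :: "(bool \<times> 'p) list set \<Rightarrow> 'a"
    and \<iota> :: "'p \<Rightarrow> 'a"
  assumes G: "group G"
    and S: "finite S" "S \<subseteq> carrier G" "generate G S = carrier G"
    and P: "pregroup P"
    and iso: "\<phi> \<in> iso (universal_group P) G"
    and embedding: "\<And>p. p \<in> carrier P \<Longrightarrow> \<iota> p = \<phi> (canonical_map P p)"
    and P6: "\<And>x y a. x \<in> carrier P \<Longrightarrow> y \<in> carrier P \<Longrightarrow> a \<in> carrier P \<Longrightarrow>
      (x, y) \<notin> defd P \<Longrightarrow> (x, a) \<in> defd P \<Longrightarrow> (pinv P a, y) \<in> defd P \<Longrightarrow>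
      a \<in> pregroup_base P"
    and H0: "finite (pregroup_base P)"
    and H1: "\<exists>C\<^sub>1>0. \<forall>p \<in> carrier P. \<forall>q \<in> carrier P. \<forall>A B C.
      geodesic_triangle (cayley_graph G S) (cayley_dist G S)
        (vertex \<one>) (vertex (\<iota> p)) (vertex (\<iota> p \<otimes> \<iota> q)) A B C \<longrightarrow>
      thin_triangle (cayley_dist G S) C\<^sub>1 A B C"
    and H2: "\<exists>C\<^sub>2>0. \<forall>p \<in> carrier P. \<forall>q \<in> carrier P.
      gromov_product (word_dist G S) (inv (\<iota> p)) (\<iota> q) \<one> > C\<^sub>2 \<longrightarrow>
      \<iota> p \<otimes> \<iota> q \<in> \<iota> ` carrier P"
    and H3: "\<exists>C\<^sub>3 :: real. \<forall>p \<in> carrier P. \<forall>\<gamma>.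
      geodesic_path (cayley_graph G S) (cayley_dist G S) \<gamma> (vertex \<one>) (vertex (\<iota> p)) \<longrightarrow>
      (\<forall>x \<in> carrier G.
        vertex x \<in> \<gamma> ` {0..cayley_dist G S (vertex \<one>) (vertex (\<iota> p))} \<longrightarrow>
        x \<in> \<iota> ` carrier P \<or>
        (\<exists>p\<^sub>1 \<in> carrier P. \<exists>p\<^sub>2 \<in> carrier P. reduced_product P [p\<^sub>1, p\<^sub>2] \<and>
          x = \<iota> p\<^sub>1 \<otimes> \<iota> p\<^sub>2 \<and> real (word_length G S (\<iota> p\<^sub>2)) \<le> C\<^sub>3))"
  shows "(\<exists>\<delta>>0. cayley_thin G S \<delta>) \<and> word_hyperbolic G \<and> word_hyperbolic (universal_group P)"
proof -
  let ?U = "universal_group P"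
  have GS: "generated_group G S"
    using G S by (simp add: generated_group_def generated_group_axioms_def)
  have rigid: "rigid_pregroup P" using P P6 by (simp add: rigid_pregroup_def rigid_pregroup_axioms_def)
  interpret PG: group_of_pregroup P G S \<phi> \<iota>
    using rigid GS iso embedding by (simp add: group_of_pregroup_def group_of_pregroup_axioms_def)
  obtain C where C: "\<And>p q A B C'. p \<in> carrier P \<Longrightarrow> q \<in> carrier P \<Longrightarrow>
      geodesic_triangle (cayley_graph G S) (cayley_dist G S)
        (vertex \<one>) (vertex (\<iota> p)) (vertex (\<iota> p \<otimes> \<iota> q)) A B C' \<Longrightarrow>
      thin_triangle (cayley_dist G S) C A B C'"
    using H1 by blast
  have thin: "\<exists>w \<in> PG.between \<one> (\<iota> p \<otimes> \<iota> q) \<union> PG.between (\<iota> p) (\<iota> p \<otimes> \<iota> q).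
      word_dist G S z w \<le> C + 1"
    if "p \<in> carrier P" "q \<in> carrier P" "z \<in> PG.between \<one> (\<iota> p)" for p q z
    by (rule PG.between_thin_if_triangle_thin[OF _ _ _ C[OF that(1,2)] that(3)]) (use that in auto)
  have "\<exists>\<delta>>0. cayley_thin G S \<delta>"
    by (rule group_of_thin_pregroup.cayley_graph_thin[OF PG.group_of_thin_pregroupI[OF S(1) H0 thin]])
  moreover from this have "word_hyperbolic G" using G S unfolding word_hyperbolic_def by blast
  moreover have "word_hyperbolic ?U"
  proof -
    have U: "group ?U" unfolding universal_group_def by (rule group_presented_group)
    interpret U: group ?U by (rule U)
    define \<psi> where "\<psi> = inv_into (carrier ?U) \<phi>"
    have \<psi>: "\<psi> \<in> iso G ?U" unfolding \<psi>_def by (rule U.iso_set_sym[OF iso])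
    have \<phi>\<psi>: "\<phi> (\<psi> g) = g" if "g \<in> carrier G" for g
      using that iso by (simp add: \<psi>_def iso_def bij_betw_def f_inv_into_f)
    have \<psi>\<phi>: "\<psi> (\<phi> u) = u" if "u \<in> carrier ?U" for u
      using that iso by (simp add: \<psi>_def iso_def bij_betw_def)
    have \<psi>_hom: "\<psi> \<in> hom G ?U" using \<psi> by (simp add: iso_def)
    interpret \<psi>: group_hom G ?U \<psi> using \<psi>_hom by unfold_locales
    have surj: "\<psi> ` carrier G = carrier ?U" using \<psi> by (simp add: iso_def bij_betw_def)
    let ?T = "\<psi> ` S"
    have T: "finite ?T" "?T \<subseteq> carrier ?U" "generate ?U ?T = carrier ?U"
      using S surj \<psi>.generate_img[of S] by auto
    have UT: "generated_group ?U ?T"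
      using U T by (simp add: generated_group_def generated_group_axioms_def)
    have id: "(\<lambda>u. u) \<in> iso ?U ?U" by (simp add: iso_def hom_def bij_betw_def)
    interpret PU: group_of_pregroup P ?U ?T "\<lambda>u. u" "canonical_map P"
      using rigid UT id by (simp add: group_of_pregroup_def group_of_pregroup_axioms_def)
    have canonical: "canonical_map P p = \<psi> (\<iota> p)" if "p \<in> carrier P" for p
      using embedding[OF that] \<psi>\<phi>[OF PU.\<iota>_closed[OF that]] by simp
    have "\<exists>w \<in> PU.between \<one>\<^bsub>?U\<^esub> (canonical_map P p \<otimes>\<^bsub>?U\<^esub> canonical_map P q) \<union>
        PU.between (canonical_map P p) (canonical_map P p \<otimes>\<^bsub>?U\<^esub> canonical_map P q).
        word_dist ?U ?T z w \<le> C + 1"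
      if p: "p \<in> carrier P" and q: "q \<in> carrier P" and z: "z \<in> PU.between \<one>\<^bsub>?U\<^esub> (canonical_map P p)"
      for p q z
    proof -
      have c: "\<iota> p \<in> carrier G" "\<iota> q \<in> carrier G" "\<iota> p \<otimes> \<iota> q \<in> carrier G" using p q by auto
      have zU: "z \<in> carrier ?U" using z PU.between_closed by blast
      then have z': "\<phi> z \<in> carrier G" "z = \<psi> (\<phi> z)" using iso \<psi>\<phi> by (auto simp: iso_def hom_def)
      note btw = iso_between[OF GS UT \<psi> HOL.refl]
      have "\<phi> z \<in> PG.between \<one> (\<iota> p)"
        using btw[of \<one> "\<iota> p" "\<phi> z"] z z' c canonical[OF p] by simp
      then obtain w where w: "w \<in> PG.between \<one> (\<iota> p \<otimes> \<iota> q) \<union> PG.between (\<iota> p) (\<iota> p \<otimes> \<iota> q)"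
        "word_dist G S (\<phi> z) w \<le> C + 1" using thin[OF p q] by blast
      have wc: "w \<in> carrier G" using w PG.between_closed by blast
      have "word_dist ?U ?T z (\<psi> w) \<le> C + 1"
        using iso_imp_word_dist_eq[OF GS UT \<psi> HOL.refl z'(1) wc] z'(2) w(2) by simp
      moreover have "canonical_map P p \<otimes>\<^bsub>?U\<^esub> canonical_map P q = \<psi> (\<iota> p \<otimes> \<iota> q)"
        using canonical p q c by simp
      ultimately show ?thesis
        using w btw[OF _ c(3) wc, of \<one>] btw[OF c(1,3) wc] canonical[OF p]
        by (intro bexI[of _ "\<psi> w"]) auto
    qed
    from group_of_thin_pregroup.cayley_graph_thin[OF PU.group_of_thin_pregroupI[OF T(1) H0 this]]
    show ?thesis using U T unfolding word_hyperbolic_def by blast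
  qed
  ultimately show ?thesis by blast
qed

end
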